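(* Let $\lambda\ge 0$, let $T>0$, and let $u_{0,1},u_{0,2}$ be finite Dirac mixtures on $\mathbb{R}^d$ with supports $A_1,A_2$. For every $x_T\in\mathbb{R}^d$, let $X=(X_t)_{t\in(0,T]}$ be the solution of the generation ODE $\dot X_t=-\nabla V_\lambda(X_t,t)$, $t\in(0,T]$, with $X_T=x_T$, and let $Y_\tau:=X_{Te^{-\tau}}$, $\tau\ge 0$. For every sequence $\tau_j\to\infty$, the family of time-shifted trajectories $Y^j_\tau:=Y_{\tau+\tau_j}$, $\tau\ge0$, is relatively compact in $C_{\mathrm{loc}}([0,\infty);\mathbb{R}^d)$. Moreover, every subsequential limit $Z$ of $(Y^j)_j$ in $C_{\mathrm{loc}}([0,\infty);\mathbb{R}^d)$ is a global Carathéodory solution of the following differential inclusion: 1. if $0\le\lambda\le1$: $\dot Z_\tau\in-\frac14\,\partial^C\Phi_\lambda(Z_\tau)$ for a.e. $\tau\ge0$; 2. if $\lambda>1$: $\dot Z_\tau\in-\frac14\,\widehat{\partial}\Phi_\lambda(Z_\tau)$ for a.e. $\tau\ge0$.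
   Context: A finite Dirac mixture on $\mathbb{R}^d$ is a probability measure $\sum_{k=1}^n w_k\delta_{a_k}$ with $n\ge1$, $a_k\in\mathbb{R}^d$, $w_k>0$, $\sum_k w_k=1$. Its support is $\{a_1,\dots,a_n\}$. Heat flows: for $i=1,2$ and $t>0$, $u_i(\cdot,t)=G_t*u_{0,i}$ with $G_t(z)=(4\pi t)^{-d/2}e^{-\|z\|^2/(4t)}$ (the solution of $\partial_tu_i=\Delta u_i$ with initial datum $u_{0,i}$). Set $V_\lambda(x,t)=\lambda\log u_1(x,t)+(1-\lambda)\log u_2(x,t)$; $\nabla$ is the gradient in $x$. Geometric potential: $A_i=\mathrm{supp}(u_{0,i})$, $d_i(x)=\mathrm{dist}(x,A_i)$, $\Phi_\lambda(x)=\lambda d_1(x)^2+(1-\lambda)d_2(x)^2$. Clarke subdifferential of a locally Lipschitz $f:\mathbb{R}^d\to\mathbb{R}$: $\partial^Cf(x)=\mathrm{conv}\{\lim_k\nabla f(x_k): x_k\to x,\ f \text{ differentiable at each } x_k\}$ (over all sequences for which the limit exists). Outer Clarke subdifferential of $\Phi_\lambda$: $\widehat{\partial}\Phi_\lambda(x)=\lambda\,\partial^C(d_1^2)(x)+(1-\lambda)\,\partial^C(d_2^2)(x)$ (Minkowski sum). A global Carathéodory solution of $\dot Z_\tau\in\mathcal F(Z_\tau)$, $Z_0=z_0$, for a set-valued map $\mathcal F:\mathbb{R}^d\rightrightarrows\mathbb{R}^d$, is an absolutely continuous (on bounded intervals) curve $Z:[0,\infty)\to\mathbb{R}^d$ for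 which there is a measurable $\xi$ with $\xi(\tau)\in\mathcal F(Z_\tau)$ for a.e. $\tau\ge0$ and $Z_\tau=z_0+\int_0^\tau\xi(s)\,ds$ for all $\tau\ge0$. $C_{\mathrm{loc}}$ refers to the topology of locally uniform convergence. *)

theory Defs
  imports "HOL-Probability.Probability"
begin

definition finite_dirac_mixture :: "'a::euclidean_space measure \<Rightarrow> bool" where
  "finite_dirac_mixture \<mu> \<longleftrightarrow>
     sets \<mu> = sets borel \<and>
     (\<exists>n\<ge>1. \<exists>(a :: nat \<Rightarrow> 'a) (w :: nat \<Rightarrow> real).
        (\<forall>k<n. w k > 0) \<and> (\<Sum>k<n. w k) = 1 \<and>
        (\<forall>B\<in>sets borel. emeasure \<mu> B = (\<Sum>k<n. ennreal (w k) * emeasure (return borel (a k)) B)))"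

text \<open>The topological support; \<open>measure_support_dirac_mixture\<close> identifies it with the set of
  points of a finite Dirac mixture.\<close>

definition measure_support :: "'a::topological_space measure \<Rightarrow> 'a set" where
  "measure_support \<mu> = {x. \<forall>U. open U \<and> x \<in> U \<longrightarrow> emeasure \<mu> U > 0}"

lemma measure_support_dirac_mixture:
  fixes a :: "nat \<Rightarrow> 'a::euclidean_space" and w :: "nat \<Rightarrow> real"
  assumes pos: "\<forall>k<n. w k > 0"
    and \<mu>: "\<forall>B\<in>sets borel. emeasure \<mu> B = (\<Sum>k<n. ennreal (w k) * emeasure (return borel (a k)) B)"
  shows "measure_support \<mu> = a ` {..<n}"
proof (rule set_eqI)
  fix x
  have eq: "emeasure \<mu> U > 0 \<longleftrightarrow> (\<exists>k<n. a k \<in> U)" if "open U" for U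
  proof -
    have "emeasure \<mu> U = (\<Sum>k<n. ennreal (w k) * indicator U (a k))"
      using \<mu> that by (simp add: borel_open)
    moreover have "(\<Sum>k<n. ennreal (w k) * indicator U (a k)) = 0 \<longleftrightarrow> (\<forall>k<n. a k \<notin> U)"
      using pos by (force simp: indicator_def)
    ultimately show ?thesis
      by (auto simp: zero_less_iff_neq_zero)
  qed
  show "x \<in> measure_support \<mu> \<longleftrightarrow> x \<in> a ` {..<n}"
  proof
    assume x: "x \<in> measure_support \<mu>"
    show "x \<in> a ` {..<n}"
    proof (rule ccontr)
      assume nx: "x \<notin> a ` {..<n}"
      have op: "open (- (a ` {..<n}))"
        by (intro open_Compl finite_imp_closed) simp
      have "emeasure \<mu> (- (a ` {..<n})) > 0"
        using x op nx unfolding measure_support_def by blast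
      then show False using eq[OF op] by auto
    qed
  next
    assume "x \<in> a ` {..<n}"
    then show "x \<in> measure_support \<mu>"
      unfolding measure_support_def using eq by auto
  qed
qed

definition heat_kernel :: "real \<Rightarrow> 'a::euclidean_space \<Rightarrow> real" where
  "heat_kernel t z = (4 * pi * t) powr (- real DIM('a) / 2) * exp (- (norm z)\<^sup>2 / (4 * t))"

definition heat_flow :: "'a::euclidean_space measure \<Rightarrow> 'a \<Rightarrow> real \<Rightarrow> real" where
  "heat_flow \<mu> x t = (LINT y|\<mu>. heat_kernel t (x - y))"

definition log_potential ::
  "real \<Rightarrow> 'a::euclidean_space measure \<Rightarrow> 'a measure \<Rightarrow> 'a \<Rightarrow> real \<Rightarrow> real" where
  "log_potential lam \<mu>1 \<mu>2 x t = lam * ln (heat_flow \<mu>1 x t) + (1 - lam) * ln (heat_flow \<mu>2 x t)"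

definition gradient :: "('a::euclidean_space \<Rightarrow> real) \<Rightarrow> 'a \<Rightarrow> 'a" where
  "gradient f x = (THE D. GDERIV f x :> D)"

lemma gradient_eqI:
  fixes f :: "'a::euclidean_space \<Rightarrow> real"
  assumes "GDERIV f x :> D"
  shows "gradient f x = D"
  unfolding gradient_def
proof (rule the_equality)
  show "GDERIV f x :> D" by (rule assms)
next
  fix D' assume "GDERIV f x :> D'"
  then have "(\<lambda>h. inner h D') = (\<lambda>h. inner h D)"
    using assms unfolding gderiv_def by (rule has_derivative_unique)
  then show "D' = D"
    by (metis inner_commute vector_eq_ldot)
qed

text \<open>The solution lives on \<open>(0, T]\<close>; its derivative at the endpoint \<open>T\<close> is one-sided.\<close>

definition generation_solution ::
  "real \<Rightarrow> 'a::euclidean_space measure \<Rightarrow> 'a measure \<Rightarrow> real \<Rightarrow> 'a \<Rightarrow> (real \<Rightarrow> 'a) \<Rightarrow> bool" where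
  "generation_solution lam \<mu>1 \<mu>2 T xT X \<longleftrightarrow>
     (\<forall>t\<in>{0<..T}. (X has_vector_derivative
         - gradient (\<lambda>x. log_potential lam \<mu>1 \<mu>2 x t) (X t)) (at t within {0<..T})) \<and>
     X T = xT"

definition geometric_potential ::
  "real \<Rightarrow> 'a::euclidean_space set \<Rightarrow> 'a set \<Rightarrow> 'a \<Rightarrow> real" where
  "geometric_potential lam A1 A2 x = lam * (infdist x A1)\<^sup>2 + (1 - lam) * (infdist x A2)\<^sup>2"

definition clarke_subdifferential :: "('a::euclidean_space \<Rightarrow> real) \<Rightarrow> 'a \<Rightarrow> 'a set" where
  "clarke_subdifferential f x = convex hull
     {v. \<exists>s :: nat \<Rightarrow> 'a. s \<longlonglongrightarrow> x \<and> (\<forall>k. f differentiable at (s k)) \<and>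
           (\<lambda>k. gradient f (s k)) \<longlonglongrightarrow> v}"

definition outer_clarke_subdifferential ::
  "real \<Rightarrow> 'a::euclidean_space set \<Rightarrow> 'a set \<Rightarrow> 'a \<Rightarrow> 'a set" where
  "outer_clarke_subdifferential lam A1 A2 x =
     {lam *\<^sub>R v + (1 - lam) *\<^sub>R w | v w.
        v \<in> clarke_subdifferential (\<lambda>z. (infdist z A1)\<^sup>2) x \<and>
        w \<in> clarke_subdifferential (\<lambda>z. (infdist z A2)\<^sup>2) x}"

definition absolutely_continuous_curve :: "real \<Rightarrow> real \<Rightarrow> (real \<Rightarrow> 'a::metric_space) \<Rightarrow> bool" where
  "absolutely_continuous_curve a b f \<longleftrightarrow>
     (\<forall>\<epsilon>>0. \<exists>\<delta>>0. \<forall>D :: (real \<times> real) set.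
        finite D \<and> (\<forall>(s, t)\<in>D. a \<le> s \<and> s \<le> t \<and> t \<le> b) \<and>
        pairwise (\<lambda>(s, t) (s', t'). disjnt {s<..<t} {s'<..<t'}) D \<and>
        (\<Sum>(s, t)\<in>D. t - s) < \<delta> \<longrightarrow>
        (\<Sum>(s, t)\<in>D. dist (f s) (f t)) < \<epsilon>)"

text \<open>Integrability of \<open>\<xi>\<close> on bounded intervals is required explicitly because the Bochner
  integral of a non-integrable function is \<open>0\<close> by convention.\<close>

definition caratheodory_solution ::
  "('a::euclidean_space \<Rightarrow> 'a set) \<Rightarrow> 'a \<Rightarrow> (real \<Rightarrow> 'a) \<Rightarrow> bool" where
  "caratheodory_solution F z0 Z \<longleftrightarrow>
     (\<forall>b\<ge>0. absolutely_continuous_curve 0 b Z) \<and>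
     (\<exists>\<xi> :: real \<Rightarrow> 'a.
        \<xi> \<in> borel_measurable (lebesgue_on {0..}) \<and>
        (AE \<tau> in lebesgue_on {0..}. \<xi> \<tau> \<in> F (Z \<tau>)) \<and>
        (\<forall>\<tau>\<ge>0. set_integrable lebesgue {0..\<tau>} \<xi> \<and>
               Z \<tau> = z0 + (LINT s:{0..\<tau>}|lebesgue. \<xi> s)))"

text \<open>A continuous function on \<open>[0, \<infinity>)\<close> is represented by its extension to \<^typ>\<open>real\<close> that is
  \<^const>\<open>undefined\<close> on negative arguments, so that it is determined by its values on \<open>[0, \<infinity>)\<close>.\<close>

definition C_space :: "(real \<Rightarrow> 'a::metric_space) set" where
  "C_space = {f \<in> extensional {0..}. continuous_on {0..} f}"

definition C_loc :: "(real \<Rightarrow> 'a::metric_space) topology" where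
  "C_loc = topology (\<lambda>U. U \<subseteq> C_space \<and>
     (\<forall>f\<in>U. \<exists>K e. compact K \<and> K \<subseteq> {0..} \<and> e > 0 \<and>
        {g \<in> C_space. \<forall>t\<in>K. dist (f t) (g t) < e} \<subseteq> U))"

lemma openin_C_loc:
  "openin C_loc U \<longleftrightarrow> U \<subseteq> C_space \<and>
     (\<forall>f\<in>U. \<exists>K e. compact K \<and> K \<subseteq> {0..} \<and> e > 0 \<and>
        {g \<in> C_space. \<forall>t\<in>K. dist (f t) (g t) < e} \<subseteq> (U :: (real \<Rightarrow> 'a::metric_space) set))"
proof -
  let ?L = "\<lambda>U :: (real \<Rightarrow> 'a) set. U \<subseteq> C_space \<and>
     (\<forall>f\<in>U. \<exists>K e. compact K \<and> K \<subseteq> {0..} \<and> e > 0 \<and>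
        {g \<in> C_space. \<forall>t\<in>K. dist (f t) (g t) < e} \<subseteq> U)"
  have "istopology ?L"
    unfolding istopology_def
  proof (intro conjI allI impI)
    fix S T assume S: "?L S" and T: "?L T"
    show "S \<inter> T \<subseteq> C_space" using S by blast
    show "\<forall>f\<in>S \<inter> T. \<exists>K e. compact K \<and> K \<subseteq> {0..} \<and> e > 0 \<and>
        {g \<in> C_space. \<forall>t\<in>K. dist (f t) (g t) < e} \<subseteq> S \<inter> T"
    proof
      fix f assume f: "f \<in> S \<inter> T"
      obtain K e where K: "compact K" "K \<subseteq> {0..}" "e > 0"
          "{g \<in> C_space. \<forall>t\<in>K. dist (f t) (g t) < e} \<subseteq> S"
        using S f by blast
      obtain K' e' where K': "compact K'" "K' \<subseteq> {0..}" "e' > 0"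
          "{g \<in> C_space. \<forall>t\<in>K'. dist (f t) (g t) < e'} \<subseteq> T"
        using T f by blast
      have "{g \<in> C_space. \<forall>t\<in>K \<union> K'. dist (f t) (g t) < min e e'} \<subseteq> S \<inter> T"
        using K(4) K'(4) by auto
      then show "\<exists>K e. compact K \<and> K \<subseteq> {0..} \<and> e > 0 \<and>
        {g \<in> C_space. \<forall>t\<in>K. dist (f t) (g t) < e} \<subseteq> S \<inter> T"
        using K(1-3) K'(1-3) by (intro exI[of _ "K \<union> K'"] exI[of _ "min e e'"]) auto
    qed
  next
    fix \<K> assume *: "\<forall>K\<in>\<K>. ?L K"
    then show "\<Union>\<K> \<subseteq> C_space" by blast
    show "\<forall>f\<in>\<Union>\<K>. \<exists>K e. compact K \<and> K \<subseteq> {0..} \<and> e > 0 \<and>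
        {g \<in> C_space. \<forall>t\<in>K. dist (f t) (g t) < e} \<subseteq> \<Union>\<K>"
    proof
      fix f assume "f \<in> \<Union>\<K>"
      then obtain U where U: "U \<in> \<K>" "f \<in> U" by blast
      then have "?L U" using * by simp
      then obtain K e where Ke: "compact K" "K \<subseteq> {0..}" "e > 0"
          "{g \<in> C_space. \<forall>t\<in>K. dist (f t) (g t) < e} \<subseteq> U"
        using U(2) by meson
      have "{g \<in> C_space. \<forall>t\<in>K. dist (f t) (g t) < e} \<subseteq> \<Union>\<K>"
        using Ke(4) U(1) by (meson Sup_upper order_trans)
      with Ke(1-3) show "\<exists>K e. compact K \<and> K \<subseteq> {0..} \<and> e > 0 \<and>
        {g \<in> C_space. \<forall>t\<in>K. dist (f t) (g t) < e} \<subseteq> \<Union>\<K>"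
        by (intro exI[of _ K] exI[of _ e]) simp
    qed
  qed
  then show ?thesis
    unfolding C_loc_def by (simp add: topology_inverse')
qed

lemma topspace_C_loc: "topspace C_loc = (C_space :: (real \<Rightarrow> 'a::metric_space) set)"
proof -
  have "openin C_loc (C_space :: (real \<Rightarrow> 'a) set)"
    unfolding openin_C_loc
    by (intro conjI ballI exI[of _ "{}"] exI[of _ "1::real"]) auto
  then show ?thesis
    unfolding topspace_def using openin_C_loc by blast
qed

lemma openin_C_loc_ball:
  fixes f :: "real \<Rightarrow> 'a::metric_space"
  assumes "f \<in> C_space" "compact K" "K \<subseteq> {0..}"
  shows "openin C_loc {g \<in> C_space. \<forall>t\<in>K. dist (f t) (g t) < e}"
  unfolding openin_C_loc
proof (intro conjI ballI)
  fix g assume g: "g \<in> {g \<in> C_space. \<forall>t\<in>K. dist (f t) (g t) < e}"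
  show "\<exists>K' e'. compact K' \<and> K' \<subseteq> {0..} \<and> e' > 0 \<and>
        {h \<in> C_space. \<forall>t\<in>K'. dist (g t) (h t) < e'}
          \<subseteq> {g \<in> C_space. \<forall>t\<in>K. dist (f t) (g t) < e}"
  proof (cases "K = {}")
    case True
    then show ?thesis by (intro exI[of _ "{}"] exI[of _ "1::real"]) auto
  next
    case False
    have "continuous_on K f" "continuous_on K g"
      using assms g by (auto simp: C_space_def intro: continuous_on_subset)
    then have "continuous_on K (\<lambda>t. dist (f t) (g t))"
      by (intro continuous_intros)
    then obtain t0 where t0: "t0 \<in> K" "\<forall>t\<in>K. dist (f t) (g t) \<le> dist (f t0) (g t0)"
      using continuous_attains_sup[OF assms(2) False] by blast
    define e' where "e' = e - dist (f t0) (g t0)"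
    have "e' > 0" using g t0 by (auto simp: e'_def)
    moreover have "dist (f t) (h t) < e" if "t \<in> K" "dist (g t) (h t) < e'" for t h
      using dist_triangle[of "f t" "h t" "g t"] t0(2) that by (fastforce simp: e'_def)
    ultimately show ?thesis
      using assms by (intro exI[of _ K] exI[of _ e']) auto
  qed
qed blast

lemma limitin_C_loc_iff:
  fixes f :: "real \<Rightarrow> 'a::metric_space"
  assumes "\<And>n. F n \<in> C_space"
  shows "limitin C_loc F f sequentially \<longleftrightarrow>
     f \<in> C_space \<and> (\<forall>K. compact K \<and> K \<subseteq> {0..} \<longrightarrow> uniform_limit K F f sequentially)"
proof
  assume L: "limitin C_loc F f sequentially"
  then have f: "f \<in> C_space" by (simp add: limitin_def topspace_C_loc)
  moreover have "uniform_limit K F f sequentially" if K: "compact K" "K \<subseteq> {0..}" for K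
    unfolding uniform_limit_iff
  proof (intro allI impI)
    fix e :: real assume "e > 0"
    then have "\<forall>\<^sub>F n in sequentially. F n \<in> {g \<in> C_space. \<forall>t\<in>K. dist (f t) (g t) < e}"
      using f by (intro limitinD[OF L] openin_C_loc_ball[OF f K]) auto
    then show "\<forall>\<^sub>F n in sequentially. \<forall>t\<in>K. dist (F n t) (f t) < e"
      by eventually_elim (auto simp: dist_commute)
  qed
  ultimately show "f \<in> C_space \<and> (\<forall>K. compact K \<and> K \<subseteq> {0..} \<longrightarrow> uniform_limit K F f sequentially)"
    by blast
next
  assume R: "f \<in> C_space \<and> (\<forall>K. compact K \<and> K \<subseteq> {0..} \<longrightarrow> uniform_limit K F f sequentially)"
  show "limitin C_loc F f sequentially"
    unfolding limitin_def topspace_C_loc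
  proof (intro conjI allI impI)
    fix U assume "openin C_loc U \<and> f \<in> U"
    then obtain K e where K: "compact K" "K \<subseteq> {0..}" "e > 0"
        "{g \<in> C_space. \<forall>t\<in>K. dist (f t) (g t) < e} \<subseteq> U"
      unfolding openin_C_loc by blast
    then have "\<forall>\<^sub>F n in sequentially. \<forall>t\<in>K. dist (F n t) (f t) < e"
      using R unfolding uniform_limit_iff by blast
    then show "\<forall>\<^sub>F n in sequentially. F n \<in> U"
      by eventually_elim (use K(4) assms in \<open>auto simp: dist_commute\<close>)
  qed (use R in blast)
qed

definition relatively_compact_in :: "'a topology \<Rightarrow> 'a set \<Rightarrow> bool" where
  "relatively_compact_in X S \<longleftrightarrow> S \<subseteq> topspace X \<and> compactin X (X closure_of S)"

text \<open>\<open>Y\<^sub>\<tau> = X\<^bsub>T exp (-\<tau>)\<^esub>\<close> shifted in time by \<open>\<sigma>\<close>, as an element of the function space.\<close>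

definition shifted_trajectory :: "real \<Rightarrow> (real \<Rightarrow> 'a) \<Rightarrow> real \<Rightarrow> real \<Rightarrow> 'a" where
  "shifted_trajectory T X \<sigma> = (\<lambda>\<tau>\<in>{0..}. X (T * exp (- (\<tau> + \<sigma>))))"

end

theory Submission
  imports Defs
begin

text \<open>Since \<open>\<nabla> log u\<^sub>i = - (x - m\<^sub>i(x,t)) / (2t)\<close>, where \<open>m\<^sub>i(x,t)\<close> is the Gibbs average of \<open>A\<^sub>i\<close> with
  weights proportional to \<open>w\<^sub>k exp (- |x - a\<^sub>k|\<^sup>2 / 4t)\<close>, the rescaled trajectory satisfies
  \<open>Y' = - (Y - lam m\<^sub>1 - (1 - lam) m\<^sub>2) / 2\<close>. The averages are bounded, so \<open>Y\<close> is bounded and Lipschitz,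
  which gives compactness. As \<open>t \<rightarrow> 0\<close> the weights concentrate on the points of \<open>A\<^sub>i\<close> nearest to \<open>x\<close>;
  the velocities therefore approach the convex set of all \<open>- (z - lam m\<^sub>1 - (1 - lam) m\<^sub>2) / 2\<close> with
  \<open>m\<^sub>i\<close> in the convex hull of the nearest points of \<open>z\<close>, and a convexity argument transfers this
  inclusion to the derivative of the limit. Finally, this set is contained in the scaled outer Clarke
  subdifferential, and for \<open>0 \<le> lam \<le> 1\<close> in the scaled Clarke subdifferential of the potential.\<close>

section \<open>Limits of differential equations\<close>

text \<open>The function \<open>F x = f x + (L + 1) x\<close> is bi-Lipschitz, so the image of Lebesgue measure under its
  inverse is absolutely continuous; its Radon--Nikodym density is \<open>F'\<close>.\<close>

lemma lipschitz_real_integral_representation: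
  fixes f :: "real \<Rightarrow> real"
  assumes lip: "L-lipschitz_on UNIV f"
  obtains g where "g \<in> borel_measurable borel"
    and "\<And>a b. a \<le> b \<Longrightarrow> g absolutely_integrable_on {a..b}"
    and "\<And>a b. a \<le> b \<Longrightarrow> (g has_integral (f b - f a)) {a..b}"
proof -
  define F where "F x = f x + (L + 1) * x" for x
  have L: "L \<ge> 0" using lip by (rule lipschitz_on_nonneg)
  have fl: "\<bar>f x - f y\<bar> \<le> L * \<bar>x - y\<bar>" for x y
    using lipschitz_onD[OF lip, of x y] by (simp add: dist_real_def)
  \<comment> \<open>Slope \<open>L + 1\<close> instead of \<open>L\<close> makes \<open>F\<close>
    expand distances: this yields strict monotonicity, and also the coercivity behind surjectivity,
    where \<open>y\<close> is bracketed by the values of \<open>F\<close> at \<open>- M\<close> and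
    \<open>M\<close>.\<close>
  have Fgap: "F y - F x \<ge> y - x" if "x \<le> y" for x y
    using fl[of x y] that by (auto simp: F_def algebra_simps abs_if split: if_splits)
  have smono: "strict_mono F"
  proof (rule strict_monoI)
    fix x y :: real assume "x < y"
    then show "F x < F y" using Fgap[of x y] by linarith
  qed
  have lipF: "(2 * L + 1)-lipschitz_on UNIV F"
  proof (rule lipschitz_onI)
    fix x y
    have "F x - F y = (f x - f y) + (L + 1) * (x - y)"
      by (simp add: F_def algebra_simps)
    then have "\<bar>F x - F y\<bar> \<le> \<bar>f x - f y\<bar> + \<bar>(L + 1) * (x - y)\<bar>"
      by (metis abs_triangle_ineq)
    also have "\<bar>(L + 1) * (x - y)\<bar> = (L + 1) * \<bar>x - y\<bar>"
      using L by (simp add: abs_mult)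
    also have "\<bar>f x - f y\<bar> + (L + 1) * \<bar>x - y\<bar> \<le> L * \<bar>x - y\<bar> + (L + 1) * \<bar>x - y\<bar>"
      using fl by simp
    finally show "dist (F x) (F y) \<le> (2 * L + 1) * dist x y"
      by (simp add: dist_real_def algebra_simps)
  qed (use L in simp)
  have contF: "continuous_on UNIV F"
    using lipF by (rule lipschitz_on_continuous_on)
  have "\<exists>x. F x = y" for y
  proof -
    define M where "M = \<bar>y - F 0\<bar>"
    have "F (- M) \<le> y" "y \<le> F M"
      using Fgap[of "-M" 0] Fgap[of 0 M] by (auto simp: M_def abs_if split: if_splits)
    then show ?thesis
      using IVT'[of F "-M" y M] continuous_on_subset[OF contF] by (auto simp: M_def)
  qed
  then have surj: "surj F" by (metis surjI)
  have inj: "inj F" using smono by (rule strict_mono_imp_inj_on)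
  have bij: "bij F" using inj surj by (simp add: bij_def)
  define G where "G = inv F"
  have FG: "F (G y) = y" for y
    using surj by (simp add: G_def surj_f_inv_f)
  have "mono G"
    by (rule monoI) (metis FG smono strict_mono_less_eq)
  then have Gm [measurable]: "G \<in> borel_measurable borel"
    by (rule borel_measurable_mono)
  have vim: "G -` B = F ` B" for B
    using bij by (simp add: G_def bij_vimage_eq_inv_image bij_imp_bij_inv inv_inv_eq)
  define N where "N = distr lborel borel G"
  \<comment> \<open>Lipschitz images of null sets are null.\<close>
  have "absolutely_continuous lborel N"
    unfolding absolutely_continuous_def
  proof
    fix B :: "real set" assume B: "B \<in> null_sets lborel"
    then have Bb: "B \<in> sets borel" by auto
    have "negligible B" using B by (simp add: negligible_iff_null_sets null_sets_completionI)
    then have "negligible (F ` B)"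
    proof (rule negligible_locally_Lipschitz_image[rotated])
      fix x assume "x \<in> B"
      have "\<forall>y \<in> B \<inter> UNIV. norm (F y - F x) \<le> (2 * L + 1) * norm (y - x)"
        using lipschitz_onD[OF lipF] by (auto simp: dist_norm)
      then show "\<exists>T B'. open T \<and> x \<in> T \<and> (\<forall>y \<in> B \<inter> T. norm (F y - F x) \<le> B' * norm (y - x))"
        by (intro exI[of _ UNIV] exI[of _ "2 * L + 1"]) auto
    qed simp
    then have "F ` B \<in> null_sets lebesgue" by (simp add: negligible_iff_null_sets)
    moreover have "F ` B \<in> sets borel"
      using measurable_sets[OF Gm Bb] by (simp add: vim)
    ultimately have "emeasure lborel (F ` B) = 0"
      by (simp add: null_sets_def emeasure_completion)
    then show "B \<in> null_sets N"
      using Bb by (simp add: null_sets_def N_def emeasure_distr vim)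
  qed
  then obtain h where h [measurable]: "h \<in> borel_measurable lborel" and hN: "density lborel h = N"
    using sigma_finite_measure.Radon_Nikodym[OF sigma_finite_lborel, of N] by (auto simp: N_def)
  have hint: "(\<integral>\<^sup>+x. h x * indicator {a..b} x \<partial>lborel) = ennreal (F b - F a)" if "a \<le> b" for a b
  proof -
    have "(\<integral>\<^sup>+x. h x * indicator {a..b} x \<partial>lborel) = emeasure N {a..b}"
      by (simp add: hN[symmetric] emeasure_density)
    also have "\<dots> = emeasure lborel (F ` {a..b})"
      by (simp add: N_def emeasure_distr vim)
    also have "F ` {a..b} = {F a..F b}"
    proof (intro equalityI subsetI)
      fix y assume "y \<in> {F a..F b}"
      then have "F a \<le> F (G y)" "F (G y) \<le> F b" by (auto simp: FG)
      then have "G y \<in> {a..b}" using smono by (simp add: strict_mono_less_eq)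
      then show "y \<in> F ` {a..b}" by (metis FG imageI)
    qed (use smono in \<open>auto simp: strict_mono_less_eq\<close>)
    also have "emeasure lborel {F a..F b} = ennreal (F b - F a)"
      using that smono by (simp add: strict_mono_less_eq)
    finally show ?thesis .
  qed
  \<comment> \<open>The density takes extended values. Its mass on each bounded interval is finite,
    so exhausting the line by the intervals \<open>{- real n..real n}\<close> shows that
    \<open>enn2real\<close>, which sends infinity to 0, alters it only on a null set.\<close>
  have "AE x in lborel. \<forall>n::nat. h x * indicator {- real n..real n} x \<noteq> \<infinity>"
    unfolding AE_all_countable
  proof
    fix n :: nat
    show "AE x in lborel. h x * indicator {- real n..real n} x \<noteq> \<infinity>"
      by (rule nn_integral_PInf_AE) (simp_all add: hint)
  qed
  then have fin: "AE x in lborel. h x \<noteq> \<infinity>"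
  proof (rule AE_mp, intro AE_I2 impI)
    fix x assume *: "\<forall>n::nat. h x * indicator {- real n..real n} x \<noteq> \<infinity>"
    obtain n :: nat where "\<bar>x\<bar> \<le> real n" using real_arch_simple by blast
    then have "x \<in> {- real n..real n}" by auto
    then show "h x \<noteq> \<infinity>" using *[rule_format, of n] by simp
  qed
  define g0 where "g0 x = enn2real (h x)" for x
  have g0m [measurable]: "g0 \<in> borel_measurable borel"
    unfolding g0_def using h by measurable
  have g0i: "(g0 has_integral (F b - F a)) {a..b}" if ab: "a \<le> b" for a b
  proof -
    have "(\<integral>\<^sup>+x. ennreal (g0 x * indicator {a..b} x) \<partial>lborel) = (\<integral>\<^sup>+x. h x * indicator {a..b} x \<partial>lborel)"
    proof (rule nn_integral_cong_AE, rule AE_mp[OF fin], intro AE_I2 impI)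
      fix x assume "h x \<noteq> \<infinity>"
      then show "ennreal (g0 x * indicator {a..b} x) = h x * indicator {a..b} x"
        by (auto simp: g0_def indicator_def top.not_eq_extremum)
    qed
    also have "\<dots> = ennreal (F b - F a)" by (rule hint[OF ab])
    finally have "((\<lambda>x. g0 x * indicator {a..b} x) has_integral (F b - F a)) UNIV"
      using Fgap[OF ab] ab
      by (intro nn_integral_has_integral) (auto simp: g0_def)
    moreover have "(\<lambda>x. g0 x * indicator {a..b} x) = (\<lambda>x. if x \<in> {a..b} then g0 x else 0)"
      by (auto simp: indicator_def)
    ultimately show ?thesis by (simp only: has_integral_restrict_UNIV)
  qed
  have g0a: "g0 absolutely_integrable_on {a..b}" if ab: "a \<le> b" for a b
    using g0i[OF ab] by (intro nonnegative_absolutely_integrable_1) (auto simp: g0_def)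
  show ?thesis
  proof (rule that[of "\<lambda>x. g0 x - (L + 1)"])
    show "(\<lambda>x. g0 x - (L + 1)) \<in> borel_measurable borel" by measurable
    fix a b :: real assume ab: "a \<le> b"
    show "(\<lambda>x. g0 x - (L + 1)) absolutely_integrable_on {a..b}"
      by (intro set_integral_diff g0a[OF ab] absolutely_integrable_continuous_real continuous_intros)
    have "((\<lambda>x. g0 x - (L + 1)) has_integral (F b - F a - (b - a) * (L + 1))) {a..b}"
      using has_integral_diff[OF g0i[OF ab] has_integral_const_real[of "L+1" a b]] ab by simp
    then show "((\<lambda>x. g0 x - (L + 1)) has_integral (f b - f a)) {a..b}"
      by (simp add: F_def algebra_simps)
  qed
qed

text \<open>Each coordinate of a Lipschitz curve is Lipschitz with the same constant, so the scalar
  densities can be assembled along \<open>Basis\<close>.\<close>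

lemma lipschitz_integral_representation:
  fixes f :: "real \<Rightarrow> 'a::euclidean_space"
  assumes lip: "L-lipschitz_on UNIV f"
  obtains g where "g \<in> borel_measurable borel"
    and "\<And>a b. a \<le> b \<Longrightarrow> g absolutely_integrable_on {a..b}"
    and "\<And>a b. a \<le> b \<Longrightarrow> (g has_integral (f b - f a)) {a..b}"
proof -
  have "\<exists>g. g \<in> borel_measurable borel \<and> (\<forall>a b. a \<le> b \<longrightarrow> g absolutely_integrable_on {a..b} \<and>
      (g has_integral (f b \<bullet> i - f a \<bullet> i)) {a..b})" if i: "i \<in> Basis" for i
  proof -
    have "L-lipschitz_on UNIV (\<lambda>x. f x \<bullet> i)"
    proof (rule lipschitz_onI)
      fix x y
      have "\<bar>(f x - f y) \<bullet> i\<bar> \<le> norm (f x - f y)" using i by (rule Basis_le_norm)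
      also have "\<dots> \<le> L * dist x y" using lipschitz_onD[OF lip, of x y] by (simp add: dist_norm)
      finally show "dist (f x \<bullet> i) (f y \<bullet> i) \<le> L * dist x y"
        by (simp add: dist_real_def inner_diff_left)
    qed (rule lipschitz_on_nonneg[OF lip])
    then show ?thesis
      by (rule lipschitz_real_integral_representation) blast
  qed
  then obtain G where G: "\<And>i. i \<in> Basis \<Longrightarrow> G i \<in> borel_measurable borel"
    "\<And>i a b. i \<in> Basis \<Longrightarrow> a \<le> b \<Longrightarrow> G i absolutely_integrable_on {a..b}"
    "\<And>i a b. i \<in> Basis \<Longrightarrow> a \<le> b \<Longrightarrow> (G i has_integral (f b \<bullet> i - f a \<bullet> i)) {a..b}"
    by metis
  show ?thesis
  proof (rule that[of "\<lambda>x. \<Sum>i\<in>Basis. G i x *\<^sub>R i"])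
    show "(\<lambda>x. \<Sum>i\<in>Basis. G i x *\<^sub>R i) \<in> borel_measurable borel"
      using G(1) by (intro borel_measurable_sum borel_measurable_scaleR) auto
    fix a b :: real assume ab: "a \<le> b"
    show "(\<lambda>x. \<Sum>i\<in>Basis. G i x *\<^sub>R i) absolutely_integrable_on {a..b}"
      using G(2)[OF _ ab] by (intro absolutely_integrable_sum absolutely_integrable_scaleR_right finite_Basis absolutely_integrable_scaleR_left) auto
    have "((\<lambda>x. \<Sum>i\<in>Basis. G i x *\<^sub>R i) has_integral (\<Sum>i\<in>Basis. (f b \<bullet> i - f a \<bullet> i) *\<^sub>R i)) {a..b}"
      using G(3)[OF _ ab] by (intro has_integral_sum finite_Basis has_integral_scaleR_left) auto
    also have "(\<Sum>i\<in>Basis. (f b \<bullet> i - f a \<bullet> i) *\<^sub>R i) = f b - f a"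
      by (simp add: euclidean_representation flip: inner_diff_left)
    finally show "((\<lambda>x. \<Sum>i\<in>Basis. G i x *\<^sub>R i) has_integral (f b - f a)) {a..b}" .
  qed
qed

lemma lipschitz_absolutely_continuous_curve:
  assumes "L-lipschitz_on {a..b} f"
  shows "absolutely_continuous_curve a b f"
  unfolding absolutely_continuous_curve_def
proof (intro allI impI)
  fix e :: real assume e: "e > 0"
  have L: "L \<ge> 0" using assms by (rule lipschitz_on_nonneg)
  show "\<exists>\<delta>>0. \<forall>D :: (real \<times> real) set.
        finite D \<and> (\<forall>(s, t)\<in>D. a \<le> s \<and> s \<le> t \<and> t \<le> b) \<and>
        pairwise (\<lambda>(s, t) (s', t'). disjnt {s<..<t} {s'<..<t'}) D \<and>
        (\<Sum>(s, t)\<in>D. t - s) < \<delta> \<longrightarrow>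
        (\<Sum>(s, t)\<in>D. dist (f s) (f t)) < e"
  \<comment> \<open>Dividing by \<open>L + 1\<close> rather than \<open>L\<close> keeps the witness
    positive when \<open>L = 0\<close>.\<close>
  proof (intro exI[of _ "e / (L + 1)"] conjI allI impI)
    show "e / (L + 1) > 0" using e L by simp
    fix D :: "(real \<times> real) set"
    assume D: "finite D \<and> (\<forall>(s, t)\<in>D. a \<le> s \<and> s \<le> t \<and> t \<le> b) \<and>
        pairwise (\<lambda>(s, t) (s', t'). disjnt {s<..<t} {s'<..<t'}) D \<and>
        (\<Sum>(s, t)\<in>D. t - s) < e / (L + 1)"
    have "(\<Sum>(s, t)\<in>D. dist (f s) (f t)) \<le> (\<Sum>(s, t)\<in>D. (L + 1) * (t - s))"
    proof (rule sum_mono, clarify)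
      fix s t assume "(s, t) \<in> D"
      then have st: "a \<le> s" "s \<le> t" "t \<le> b" using D by auto
      then have "dist (f s) (f t) \<le> L * (t - s)"
        using lipschitz_onD[OF assms, of s t] by (simp add: dist_real_def)
      also have "\<dots> \<le> (L + 1) * (t - s)" using st by (intro mult_right_mono) auto
      finally show "dist (f s) (f t) \<le> (L + 1) * (t - s)" .
    qed
    also have "\<dots> = (L + 1) * (\<Sum>(s, t)\<in>D. t - s)"
      by (simp add: sum_distrib_left case_prod_unfold)
    also have "\<dots> < (L + 1) * (e / (L + 1))"
      using D L by (intro mult_strict_left_mono) auto
    finally show "(\<Sum>(s, t)\<in>D. dist (f s) (f t)) < e" using L by simp
  qed
qed

text \<open>If the derivative \<open>g t\<close> of \<open>Z\<close> at a Lebesgue point were separated from \<open>F (Z t)\<close> by a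
  hyperplane, then for large \<open>j\<close> all velocities \<open>v j s\<close> with \<open>s\<close> close to \<open>t\<close> would lie on the far
  side of it, and so would the difference quotients of \<open>Z\<close>.\<close>

lemma caratheodory_solution_limit:
  fixes Y v :: "nat \<Rightarrow> real \<Rightarrow> 'a::euclidean_space"
  assumes deriv: "\<And>j t. t \<ge> 0 \<Longrightarrow> (Y j has_vector_derivative v j t) (at t within {0..})"
    and lim: "\<And>t. t \<ge> 0 \<Longrightarrow> (\<lambda>j. Y j t) \<longlonglongrightarrow> Z t"
    and lip: "L-lipschitz_on {0..} Z"
    and F: "\<And>z. convex (F z)" "\<And>z. closed (F z)"
    and usc: "\<And>t e. t \<ge> 0 \<Longrightarrow> e > 0 \<Longrightarrow>
      \<exists>d>0. \<exists>J. \<forall>j\<ge>J. \<forall>s. t \<le> s \<and> s < t + d \<longrightarrow> (\<exists>c\<in>F (Z t). norm (v j s - c) < e)"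
  shows "caratheodory_solution F (Z 0) Z"
proof -
  \<comment> \<open>Freezing \<open>Z\<close> at \<open>Z 0\<close> for negative times preserves the
    Lipschitz constant and gives a curve on the whole line.\<close>
  have "L-lipschitz_on UNIV (\<lambda>t. Z (max 0 t))"
  proof (rule lipschitz_onI)
    fix x y :: real
    have "dist (Z (max 0 x)) (Z (max 0 y)) \<le> L * dist (max 0 x) (max 0 y)"
      by (rule lipschitz_onD[OF lip]) auto
    also have "\<dots> \<le> L * dist x y"
      by (rule mult_left_mono) (auto simp: dist_real_def lipschitz_on_nonneg[OF lip])
    finally show "dist (Z (max 0 x)) (Z (max 0 y)) \<le> L * dist x y" .
  qed (rule lipschitz_on_nonneg[OF lip])
  then obtain g where g: "g \<in> borel_measurable borel"
    "\<And>a b. a \<le> b \<Longrightarrow> g absolutely_integrable_on {a..b}"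
    "\<And>a b. a \<le> b \<Longrightarrow> (g has_integral (Z (max 0 b) - Z (max 0 a))) {a..b}"
    by (rule lipschitz_integral_representation) blast
  have "g integrable_on cbox a b" for a b
    by (cases "a \<le> b") (use g(3) in \<open>auto simp: has_integral_integrable\<close>)
  \<comment> \<open>Lebesgue differentiation: off \<open>N\<close>, the averages of \<open>g\<close>
    over short intervals to the right of a point converge to its value there.\<close>
  then obtain N where N: "negligible N" and diff: "\<And>x e. \<lbrakk>x \<notin> N; 0 < e\<rbrakk> \<Longrightarrow>
      \<exists>d>0. \<forall>h. 0 < h \<and> h < d \<longrightarrow> norm (integral (cbox x (x + h *\<^sub>R One)) g /\<^sub>R h ^ DIM(real) - g x) < e"
    by (rule integrable_ccontinuous_explicit) blast
  have mem: "g t \<in> F (Z t)" if t: "t \<ge> 0" "t \<notin> N" for t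
  proof (rule ccontr)
    assume "g t \<notin> F (Z t)"
    then obtain p b where pb: "p \<bullet> g t < b" "\<And>c. c \<in> F (Z t) \<Longrightarrow> p \<bullet> c > b"
      using separating_hyperplane_closed_point[OF F] by blast
    \<comment> \<open>Two errors of size \<open>norm p * e\<close> will occur, one from the
      velocities and one from the difference quotient. This choice makes their sum smaller than the
      gap \<open>b - p \<bullet> g t\<close>; the \<open>+ 1\<close> avoids division by
      zero.\<close>
    define e where "e = (b - p \<bullet> g t) / (2 * (norm p + 1))"
    have np: "norm p + 1 > 0" by (simp add: add_nonneg_pos)
    have e: "e > 0" using pb(1) np by (simp add: e_def)
    have ep: "norm p * e < (b - p \<bullet> g t) / 2"
    proof -
      have "norm p * e < (norm p + 1) * e" using e by simp
      also have "\<dots> = (b - p \<bullet> g t) / 2" using np by (simp add: e_def field_simps)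
      finally show ?thesis .
    qed
    obtain d J where d: "d > 0" and near: "\<And>j s. j \<ge> J \<Longrightarrow> t \<le> s \<Longrightarrow> s < t + d \<Longrightarrow>
        \<exists>c\<in>F (Z t). norm (v j s - c) < e"
      using usc[OF t(1) e] by blast
    obtain d' where d': "d' > 0" and quot: "\<And>h. 0 < h \<Longrightarrow> h < d' \<Longrightarrow>
        norm (integral {t..t + h} g /\<^sub>R h - g t) < e"
      using diff[OF t(2) e] by auto
    define h where "h = min d d' / 2"
    have h: "0 < h" "h < d" "h < d'" using d d' by (auto simp: h_def)
    define m where "m = b - norm p * e"
    have vm: "p \<bullet> v j s \<ge> m" if js: "j \<ge> J" "t \<le> s" "s < t + d" for j s
    proof -
      obtain c where c: "c \<in> F (Z t)" "norm (v j s - c) < e" using near[OF js] by blast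
      have "\<bar>p \<bullet> (v j s - c)\<bar> \<le> norm p * norm (v j s - c)" by (rule Cauchy_Schwarz_ineq2)
      also have "\<dots> \<le> norm p * e" using c(2) by (simp add: mult_left_mono)
      finally show ?thesis using pb(2)[OF c(1)] by (simp add: m_def inner_diff_right abs_le_iff)
    qed
    \<comment> \<open>Projecting onto \<open>p\<close> gives a scalar function, for which the mean
      value theorem holds with equality.\<close>
    have Yinc: "p \<bullet> Y j (t + h) - p \<bullet> Y j t \<ge> m * h" if j: "j \<ge> J" for j
    proof -
      have "\<exists>x\<in>{t..t+h}. (p \<bullet> Y j (t + h)) - (p \<bullet> Y j t) = (\<lambda>y. y * (p \<bullet> v j x)) ((t + h) - t)"
      proof (rule mvt_very_simple)
        show "t \<le> t + h" using h by simp
        fix x assume x: "t \<le> x" "x \<le> t + h"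
        then have "(Y j has_vector_derivative v j x) (at x within {t..t+h})"
          using t by (intro has_vector_derivative_within_subset[OF deriv]) auto
        then have "((\<lambda>s. p \<bullet> Y j s) has_vector_derivative p \<bullet> v j x) (at x within {t..t+h})"
          by (rule bounded_linear.has_vector_derivative[OF bounded_linear_inner_right])
        then show "((\<lambda>s. p \<bullet> Y j s) has_derivative (\<lambda>y. y * (p \<bullet> v j x))) (at x within {t..t+h})"
          by (simp add: has_vector_derivative_def)
      qed
      then obtain x where x: "x \<in> {t..t+h}" "p \<bullet> Y j (t + h) - p \<bullet> Y j t = h * (p \<bullet> v j x)" by auto
      have "m \<le> p \<bullet> v j x" using x(1) h j by (intro vm) auto
      then show ?thesis using x(2) h by (simp add: mult.commute mult_left_mono)
    qed
    have "m * h \<le> p \<bullet> Z (t + h) - p \<bullet> Z t"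
    proof (rule LIMSEQ_le_const)
      show "(\<lambda>j. p \<bullet> Y j (t + h) - p \<bullet> Y j t) \<longlonglongrightarrow> p \<bullet> Z (t + h) - p \<bullet> Z t"
        using t h by (intro tendsto_intros lim) auto
      show "\<exists>N. \<forall>n\<ge>N. m * h \<le> p \<bullet> Y n (t + h) - p \<bullet> Y n t" using Yinc by blast
    qed
    moreover have "integral {t..t + h} g = Z (t + h) - Z t"
      using g(3)[of t "t + h"] t h by (auto intro!: integral_unique)
    ultimately have "m \<le> p \<bullet> (integral {t..t + h} g /\<^sub>R h)"
      using h by (simp add: inner_diff_right pos_le_divide_eq divide_inverse_commute[symmetric])
    moreover have "\<bar>p \<bullet> (integral {t..t + h} g /\<^sub>R h - g t)\<bar> \<le> norm p * e"
      using Cauchy_Schwarz_ineq2[of p "integral {t..t + h} g /\<^sub>R h - g t"] quot[OF h(1,3)]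
      by (meson less_imp_le mult_left_mono norm_ge_zero order_trans)
    ultimately have "m \<le> p \<bullet> g t + norm p * e" by (simp add: inner_diff_right abs_le_iff)
    moreover define q where "q = norm p * e"
    moreover define w where "w = p \<bullet> g t"
    ultimately have "b - q \<le> w + q" "q < (b - w) / 2" using ep by (simp_all only: m_def)
    then show False by argo
  qed
  show ?thesis
    unfolding caratheodory_solution_def
  proof (intro conjI allI impI exI[of _ g])
    fix b :: real
    show "absolutely_continuous_curve 0 b Z"
      by (rule lipschitz_absolutely_continuous_curve[OF lipschitz_on_subset[OF lip]]) auto
  next
    show "g \<in> borel_measurable (lebesgue_on {0..})"
      using g(1) by (simp add: borel_measurable_if_D measurable_completion measurable_restrict_space1)
  next
    have "N \<in> null_sets lebesgue" using N by (simp add: negligible_iff_null_sets)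
    then have "AE t in lebesgue. t \<notin> N" by (rule AE_not_in)
    then have "AE t in lebesgue. t \<in> {0..} \<longrightarrow> g t \<in> F (Z t)"
      by (rule AE_mp) (use mem in auto)
    then show "AE t in lebesgue_on {0..}. g t \<in> F (Z t)"
      by (subst AE_restrict_space_iff) auto
  next
    fix \<tau> :: real assume \<tau>: "\<tau> \<ge> 0"
    show *: "set_integrable lebesgue {0..\<tau>} g" using g(2)[OF \<tau>] .
    have "integral {0..\<tau>} g = Z \<tau> - Z 0"
      using g(3)[OF \<tau>] \<tau> by (auto intro!: integral_unique)
    then show "Z \<tau> = Z 0 + (LINT s:{0..\<tau>}|lebesgue. g s)"
      using set_lebesgue_integral_eq_integral(2)[OF *] by simp
  qed
qed

section \<open>Compactness in the space of trajectories\<close>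

text \<open>Extensionality forces distinct elements to differ at some \<open>t \<ge> 0\<close>, and
  balls over the compact set \<open>{t}\<close> separate them. This makes compact sets
  closed.\<close>

lemma Hausdorff_space_C_loc: "Hausdorff_space (C_loc :: (real \<Rightarrow> 'a::metric_space) topology)"
  unfolding Hausdorff_space_def topspace_C_loc
proof (intro allI impI)
  fix f g :: "real \<Rightarrow> 'a"
  assume fg: "f \<in> C_space \<and> g \<in> C_space \<and> f \<noteq> g"
  then obtain t where t: "t \<ge> 0" "f t \<noteq> g t"
    by (auto simp: C_space_def) (metis atLeast_iff extensionalityI)
  define e where "e = dist (f t) (g t) / 2"
  have e: "e > 0" using t by (simp add: e_def)
  let ?B = "\<lambda>h. {k \<in> C_space. \<forall>s\<in>{t}. dist (h s) (k s) < e}"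
  have "openin C_loc (?B f)" "openin C_loc (?B g)"
    by (rule openin_C_loc_ball; use fg t in auto)+
  moreover have "disjnt (?B f) (?B g)"
    unfolding disjnt_iff
  proof (intro allI notI)
    fix k assume "k \<in> ?B f \<and> k \<in> ?B g"
    then have "dist (f t) (k t) < e" "dist (g t) (k t) < e" by auto
    then show False
      using dist_triangle2[of "f t" "g t" "k t"] by (simp add: e_def)
  qed
  moreover have "f \<in> ?B f" "g \<in> ?B g" using fg e by auto
  ultimately show "\<exists>U V. openin C_loc U \<and> openin C_loc V \<and> f \<in> U \<and> g \<in> V \<and> disjnt U V"
    by blast
qed

text \<open>On an equi-Lipschitz family the topology of locally uniform convergence coincides with that
  of pointwise convergence, so that Tychonoff's theorem applies.\<close>

lemma compactin_C_loc_lipschitz: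
  fixes L M :: real
  defines "K \<equiv> {f \<in> extensional {0..}. L-lipschitz_on {0..} f \<and> (\<forall>t\<ge>0. norm (f t) \<le> M)}"
  shows "compactin C_loc (K :: (real \<Rightarrow> 'a::euclidean_space) set)"
proof (cases "L \<ge> 0")
  case False
  then have "K = {}" using lipschitz_on_nonneg unfolding K_def by blast
  then show ?thesis by simp
next
  case L: True
  let ?P = "product_topology (\<lambda>_. euclidean :: 'a topology) {0::real..}"
  have KC: "K \<subseteq> C_space"
    using lipschitz_on_continuous_on unfolding K_def C_space_def by blast
  have proj: "continuous_map ?P euclidean (\<lambda>f. f t)" if "t \<ge> 0" for t
    using that by (intro continuous_map_product_projection) auto
  \<comment> \<open>\<open>K\<close> is cut out of this compact product by the Lipschitz
    inequalities, each a closed condition on two coordinates.\<close>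
  have "compactin ?P (PiE {0..} (\<lambda>_. cball 0 M))"
    by (simp add: compactin_PiE)
  moreover have "closedin ?P {f \<in> topspace ?P. dist (f (fst st)) (f (snd st)) \<le> L * dist (fst st) (snd st)}"
    if "st \<in> {0..} \<times> {0..}" for st
  proof -
    have "continuous_map ?P euclidean (\<lambda>f. (f (fst st), f (snd st)))"
      unfolding prod_topology_euclidean[symmetric]
      by (intro continuous_map_pairedI proj) (use that in auto)
    then have "continuous_map ?P euclidean ((\<lambda>(u, v). dist u v) \<circ> (\<lambda>f. (f (fst st), f (snd st))))"
      by (rule continuous_map_compose)
        (auto simp: case_prod_unfold intro!: continuous_intros)
    then have "closedin ?P {f \<in> topspace ?P. ((\<lambda>(u, v). dist u v) \<circ> (\<lambda>f. (f (fst st), f (snd st)))) f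
        \<in> {..L * dist (fst st) (snd st)}}"
      by (rule closedin_continuous_map_preimage) auto
    then show ?thesis by simp
  qed
  then have "closedin ?P (\<Inter>st\<in>{0..} \<times> {0..}.
      {f \<in> topspace ?P. dist (f (fst st)) (f (snd st)) \<le> L * dist (fst st) (snd st)})" (is "closedin _ ?C")
    by (intro closedin_INT) auto
  ultimately have "compactin ?P (PiE {0..} (\<lambda>_. cball 0 M) \<inter> ?C)"
    by (rule compact_Int_closedin)
  also have "PiE {0..} (\<lambda>_. cball 0 M) \<inter> ?C = K"
    using L by (auto simp: K_def PiE_iff lipschitz_on_def extensional_def)
  finally have cK: "compactin ?P K" .
  \<comment> \<open>Compactness is transported as the image under the identity, from the pointwise
    topology on \<open>K\<close> to \<open>C_loc\<close>.\<close>
  have "continuous_map (subtopology ?P K) C_loc (\<lambda>f. f)"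
    unfolding continuous_map
  proof (intro conjI allI impI)
    show "(\<lambda>f. f) ` topspace (subtopology ?P K) \<subseteq> topspace C_loc"
      using KC by (auto simp: topspace_C_loc)
    fix U :: "(real \<Rightarrow> 'a) set" assume U: "openin C_loc U"
    show "openin (subtopology ?P K) {f \<in> topspace (subtopology ?P K). f \<in> U}"
    proof (subst openin_subopen, intro ballI)
      fix f assume "f \<in> {f \<in> topspace (subtopology ?P K). f \<in> U}"
      then have f: "f \<in> K" "f \<in> U" by auto
      then obtain Q e where Q: "compact Q" "Q \<subseteq> {0..}" "e > 0"
          "{g \<in> C_space. \<forall>t\<in>Q. dist (f t) (g t) < e} \<subseteq> U"
        using U unfolding openin_C_loc by meson
      \<comment> \<open>Three-epsilon argument: on a finite \<open>d\<close>-net \<open>S\<close> of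
        \<open>Q\<close> the functions are \<open>e / 3\<close>-close, and moving from a net point
        to a neighbour changes each of them by less than \<open>e / 3\<close>.\<close>
      define d where "d = e / (3 * (L + 1))"
      have d: "d > 0" using Q L by (simp add: d_def)
      have Ld: "L * d < e / 3"
      proof -
        have "L * d < (L + 1) * d" using d by simp
        also have "\<dots> = e / 3" using L by (simp add: d_def field_simps)
        finally show ?thesis .
      qed
      obtain S where S: "finite S" "S \<subseteq> Q" "Q \<subseteq> (\<Union>s\<in>S. ball s d)"
        using compactE_image[OF Q(1), of Q "\<lambda>s. ball s d"] d
        by (metis (no_types, lifting) UN_I centre_in_ball open_ball subsetI)
      define W where "W = (\<Inter>s\<in>S. {g \<in> topspace ?P. g s \<in> ball (f s) (e / 3)}) \<inter> topspace ?P"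
      have "openin ?P {g \<in> topspace ?P. g s \<in> ball (f s) (e / 3)}" if "s \<in> S" for s
        by (rule openin_continuous_map_preimage[OF proj]) (use that S Q in auto)
      then have W: "openin ?P W"
        unfolding W_def by (rule openin_INT[OF S(1)])
      have Kt: "K \<subseteq> topspace ?P" using cK by (rule compactin_subset_topspace)
      have fW: "f \<in> W" using f Kt Q by (auto simp: W_def)
      have "W \<inter> K \<subseteq> U"
      proof
        fix g assume g: "g \<in> W \<inter> K"
        have "dist (f t) (g t) < e" if t: "t \<in> Q" for t
        proof -
          obtain s where s: "s \<in> S" "dist s t < d" using S t by auto
          then have st: "s \<ge> 0" "t \<ge> 0" using S Q t by auto
          have "dist (k s) (k t) < e / 3" if "k \<in> K" for k
          proof -
            have "dist (k s) (k t) \<le> L * dist s t"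
              using that st by (auto simp: K_def intro: lipschitz_onD)
            also have "\<dots> \<le> L * d" using L s by (simp add: mult_left_mono)
            finally show ?thesis using Ld by simp
          qed
          then have "dist (f s) (f t) < e / 3" "dist (g s) (g t) < e / 3"
            using f g by auto
          moreover have "dist (f s) (g s) < e / 3" using g s by (auto simp: W_def)
          moreover have "dist (f t) (g t) \<le> dist (f s) (f t) + dist (f s) (g s) + dist (g s) (g t)"
            by (metis add.commute add_mono_thms_linordered_semiring(3) dist_commute dist_triangle dist_triangle_le order_refl)
          ultimately show ?thesis by simp
        qed
        then show "g \<in> U" using Q(4) g KC by blast
      qed
      then show "\<exists>T. openin (subtopology ?P K) T \<and> f \<in> T \<and>
          T \<subseteq> {f \<in> topspace (subtopology ?P K). f \<in> U}"
        using W fW f Kt by (intro exI[of _ "W \<inter> K"]) (auto simp: openin_subtopology)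
    qed
  qed
  moreover have "compactin (subtopology ?P K) K"
    using cK by (simp add: compactin_subtopology)
  ultimately have "compactin C_loc ((\<lambda>f. f) ` K)"
    by (rule image_compactin[rotated])
  then show ?thesis by simp
qed

text \<open>The compact family of all functions with these bounds is closed in the Hausdorff space,
  so it contains the closure of \<open>S\<close>.\<close>

lemma relatively_compact_in_C_loc_lipschitz:
  fixes S :: "(real \<Rightarrow> 'a::euclidean_space) set"
  assumes "S \<subseteq> extensional {0..}"
    and "\<And>f. f \<in> S \<Longrightarrow> L-lipschitz_on {0..} f"
    and "\<And>f t. f \<in> S \<Longrightarrow> t \<ge> 0 \<Longrightarrow> norm (f t) \<le> M"
  shows "relatively_compact_in C_loc S"
proof -
  define K where "K = {f :: real \<Rightarrow> 'a. f \<in> extensional {0..} \<and> L-lipschitz_on {0..} f \<and> (\<forall>t\<ge>0. norm (f t) \<le> M)}"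
  have K: "compactin C_loc K"
    unfolding K_def by (rule compactin_C_loc_lipschitz)
  have SK: "S \<subseteq> K" using assms by (auto simp: K_def)
  have "closedin C_loc K"
    using Hausdorff_space_C_loc K by (rule compactin_imp_closedin)
  then have "C_loc closure_of S \<subseteq> K" using SK by (intro closure_of_minimal)
  then have "compactin C_loc (C_loc closure_of S)"
    using K by (intro closed_compactin[OF K]) auto
  then show ?thesis
    using SK compactin_subset_topspace[OF K] unfolding relatively_compact_in_def by blast
qed

section \<open>Clarke subdifferential of the geometric potential\<close>

definition nearest_points :: "'a::metric_space set \<Rightarrow> 'a \<Rightarrow> 'a set" where
  "nearest_points A x = {a \<in> A. dist x a = infdist x A}"

lemma nearest_points_nonempty:
  fixes A :: "'a::heine_borel set"
  assumes "closed A" "A \<noteq> {}"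
  shows "nearest_points A x \<noteq> {}"
proof -
  obtain a where "a \<in> A" "infdist x A = dist x a"
    using infdist_attains_inf[OF assms] by blast
  then have "a \<in> nearest_points A x" by (simp add: nearest_points_def)
  then show ?thesis by blast
qed

lemma not_nearest_point_dist:
  assumes "b \<in> A" "b \<notin> nearest_points A x" "a \<in> nearest_points A x"
  shows "dist x a < dist x b"
  using assms infdist_le[of b A x] by (auto simp: nearest_points_def)

lemma infdist_eq_dist:
  assumes "a \<in> A" "\<And>b. b \<in> A \<Longrightarrow> dist x a \<le> dist x b"
  shows "infdist x A = dist x a"
proof (rule antisym)
  show "infdist x A \<le> dist x a" using assms(1) by (rule infdist_le)
  have "A \<noteq> {}" using assms(1) by auto
  then show "dist x a \<le> infdist x A"
    by (auto simp: infdist_notempty intro!: cINF_greatest assms(2))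
qed

text \<open>Finitely many strict inequalities persist in a neighbourhood of \<open>y\<close>, where
  the squared distance to \<open>A\<close> is therefore the squared distance to
  \<open>a\<close>.\<close>

lemma GDERIV_infdist_square:
  fixes A :: "'a::euclidean_space set"
  assumes A: "finite A" "a \<in> A" and near: "\<And>b. b \<in> A \<Longrightarrow> b \<noteq> a \<Longrightarrow> dist y a < dist y b"
  shows "GDERIV (\<lambda>x. (infdist x A)\<^sup>2) y :> 2 *\<^sub>R (y - a)"
proof -
  have "\<forall>\<^sub>F x in nhds y. \<forall>b\<in>A - {a}. dist x a < dist x b"
    unfolding eventually_ball_finite_distrib[OF finite_Diff[OF A(1)]]
  proof
    fix b assume "b \<in> A - {a}"
    then have "0 < dist y b - dist y a" using near by auto
    moreover have "((\<lambda>x. dist x b - dist x a) \<longlongrightarrow> dist y b - dist y a) (nhds y)"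
      by (intro tendsto_intros filterlim_ident)
    ultimately have "\<forall>\<^sub>F x in nhds y. 0 < dist x b - dist x a" by (rule order_tendstoD(1)[rotated])
    then show "\<forall>\<^sub>F x in nhds y. dist x a < dist x b" by eventually_elim simp
  qed
  then have ev: "\<forall>\<^sub>F x in nhds y. (x - a) \<bullet> (x - a) = (infdist x A)\<^sup>2"
  proof eventually_elim
    case (elim x)
    then have "infdist x A = dist x a"
      by (intro infdist_eq_dist A) (metis Diff_iff less_eq_real_def singletonD)
    then show ?case by (simp add: dist_norm power2_norm_eq_inner)
  qed
  have der: "((\<lambda>x. (x - a) \<bullet> (x - a)) has_derivative (\<lambda>h. h \<bullet> (2 *\<^sub>R (y - a)))) (at y)"
    by (auto intro!: derivative_eq_intros simp: inner_commute)
  obtain S where "open S" "y \<in> S" "\<And>x. x \<in> S \<Longrightarrow> (x - a) \<bullet> (x - a) = (infdist x A)\<^sup>2"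
    using ev unfolding eventually_nhds by blast
  with der show ?thesis
    unfolding gderiv_def by (rule has_derivative_transform_within_open)
qed

text \<open>In the difference of squared distances to \<open>b\<close> and \<open>a\<close> the
  terms quadratic in \<open>e\<close> cancel. What remains is
  \<open>c + 2 * e * (q \<bullet> a - q \<bullet> b)\<close>: for ties \<open>c = 0\<close> and the
  linear term decides, otherwise \<open>c > 0\<close> survives for small \<open>e\<close>.\<close>

lemma eventually_nearest_in_direction:
  fixes A :: "'a::euclidean_space set"
  assumes A: "finite A" and a: "a \<in> nearest_points A z"
    and q: "\<And>b. b \<in> nearest_points A z \<Longrightarrow> b \<noteq> a \<Longrightarrow> q \<bullet> b < q \<bullet> a"
  shows "\<forall>\<^sub>F e in at_right 0. \<forall>b\<in>A - {a}. dist (z + e *\<^sub>R q) a < dist (z + e *\<^sub>R q) b"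
  unfolding eventually_ball_finite_distrib[OF finite_Diff[OF A(1)]]
proof
  fix b assume b: "b \<in> A - {a}"
  define c where "c = (dist z b)\<^sup>2 - (dist z a)\<^sup>2"
  have sq: "(dist (z + e *\<^sub>R q) b)\<^sup>2 - (dist (z + e *\<^sub>R q) a)\<^sup>2 = c + 2 * e * (q \<bullet> a - q \<bullet> b)" for e
    unfolding c_def dist_norm power2_norm_eq_inner
    by (simp add: inner_simps inner_commute algebra_simps)
  have "\<forall>\<^sub>F e in at_right 0. 0 < c + 2 * e * (q \<bullet> a - q \<bullet> b)"
  proof (cases "b \<in> nearest_points A z")
    case True
    then have "c = 0" "q \<bullet> b < q \<bullet> a" using a b q by (auto simp: c_def nearest_points_def)
    then show ?thesis
      by (intro eventually_mono[OF eventually_at_right_less[of 0]]) auto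
  next
    case False
    then have "dist z a < dist z b" using b a by (intro not_nearest_point_dist) auto
    then have "c > 0" by (simp add: c_def power_strict_mono)
    moreover have "((\<lambda>e. c + 2 * e * (q \<bullet> a - q \<bullet> b)) \<longlongrightarrow> c + 2 * 0 * (q \<bullet> a - q \<bullet> b)) (at_right 0)"
      by (intro tendsto_intros)
    ultimately show ?thesis by (intro order_tendstoD(1)) auto
  qed
  then show "\<forall>\<^sub>F e in at_right 0. dist (z + e *\<^sub>R q) a < dist (z + e *\<^sub>R q) b"
  proof eventually_elim
    case (elim e)
    then have "(dist (z + e *\<^sub>R q) a)\<^sup>2 < (dist (z + e *\<^sub>R q) b)\<^sup>2" using sq[of e] by simp
    then show ?case by (rule power2_less_imp_less) simp
  qed
qed

text \<open>Strict separation of a point from a compact set is stable under small changes of the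
  direction, so the direction can be taken from any dense set.\<close>

lemma separation_dense:
  fixes S :: "'a::euclidean_space set"
  assumes S: "convex S" "compact S" "g \<notin> S" and D: "closure D = UNIV"
  obtains q b where "q \<in> D" "q \<bullet> g < b" "\<And>x. x \<in> S \<Longrightarrow> b < q \<bullet> x"
proof -
  obtain p b where p: "p \<bullet> g < b" "\<And>x. x \<in> S \<Longrightarrow> b < p \<bullet> x"
    using separating_hyperplane_closed_point[OF S(1) compact_imp_closed[OF S(2)] S(3)] by blast
  obtain R where R: "R > 0" "\<And>x. x \<in> insert g S \<Longrightarrow> norm x \<le> R"
    using compact_imp_bounded[OF compact_insert[OF S(2), of g]] unfolding bounded_pos by blast
  \<comment> \<open>On vectors of norm at most \<open>R\<close>, a change of \<open>p\<close> by
    less than \<open>e\<close> moves inner products by less than half the gap; the new threshold is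
    the midpoint of \<open>p \<bullet> g\<close> and \<open>b\<close>.\<close>
  define e where "e = (b - p \<bullet> g) / (2 * R)"
  have "e > 0" using p(1) R by (simp add: e_def)
  then obtain q where q: "q \<in> D" "dist q p < e"
    using closure_approachableD[of p D] D by (metis UNIV_I dist_commute)
  have qp: "\<bar>q \<bullet> x - p \<bullet> x\<bar> < (b - p \<bullet> g) / 2" if "x \<in> insert g S" for x
  proof -
    have "\<bar>q \<bullet> x - p \<bullet> x\<bar> \<le> norm (q - p) * norm x"
      using Cauchy_Schwarz_ineq2[of "q - p" x] by (simp add: inner_diff_left)
    also have "\<dots> \<le> norm (q - p) * R" using R(2)[OF that] by (intro mult_left_mono) auto
    also have "\<dots> < e * R" using q(2) R(1) by (simp add: dist_norm)
    also have "\<dots> = (b - p \<bullet> g) / 2" using R(1) by (simp add: e_def)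
    finally show ?thesis .
  qed
  show ?thesis
  proof (rule that[OF q(1)])
    show "q \<bullet> g < (b + p \<bullet> g) / 2" using qp[of g] unfolding abs_less_iff by (simp add: field_simps)
    fix x assume "x \<in> S"
    then show "(b + p \<bullet> g) / 2 < q \<bullet> x"
      using qp[of x] p(2)[of x] unfolding abs_less_iff by (simp add: field_simps)
  qed
qed

text \<open>The excluded directions form a finite union of hyperplanes, a null set, which has empty
  interior.\<close>

lemma closure_generic_directions:
  fixes W :: "'a::euclidean_space set"
  assumes W: "finite W" "0 \<notin> W"
  shows "closure {q. \<forall>w\<in>W. q \<bullet> w \<noteq> 0} = UNIV"
proof -
  have eq: "{q. \<forall>w\<in>W. q \<bullet> w \<noteq> 0} = - (\<Union>w\<in>W. {q. w \<bullet> q = 0})"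
    by (auto simp: inner_commute)
  have "negligible (\<Union>w\<in>W. {q. w \<bullet> q = 0})"
    using W by (intro negligible_Union) (auto intro!: negligible_hyperplane)
  then have "interior (\<Union>w\<in>W. {q. w \<bullet> q = 0}) = {}"
    by (meson interior_subset negligible_subset open_interior open_not_negligible)
  then show ?thesis unfolding eq closure_complement by simp
qed

text \<open>Limiting gradients ask for differentiability at every index, so an initial segment of
  the sequence is dropped.\<close>

lemma limiting_gradientI:
  fixes f :: "'a::euclidean_space \<Rightarrow> real"
  assumes "s \<longlonglongrightarrow> x" "\<forall>\<^sub>F k in sequentially. GDERIV f (s k) :> D k" "D \<longlonglongrightarrow> v"
  shows "\<exists>s :: nat \<Rightarrow> 'a. s \<longlonglongrightarrow> x \<and> (\<forall>k. f differentiable at (s k)) \<and>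
           (\<lambda>k. gradient f (s k)) \<longlonglongrightarrow> v"
proof -
  obtain N where N: "\<And>k. k \<ge> N \<Longrightarrow> GDERIV f (s k) :> D k"
    using assms(2) by (auto simp: eventually_sequentially)
  have "(\<lambda>k. gradient f (s (k + N))) = (\<lambda>k. D (k + N))"
    using N by (intro ext gradient_eqI) auto
  moreover have "\<forall>k. f differentiable at (s (k + N))"
    using N unfolding gderiv_def differentiable_def by (metis le_add2)
  ultimately show ?thesis
    using assms(1,3) by (intro exI[of _ "\<lambda>k. s (k + N)"]) (auto intro: LIMSEQ_ignore_initial_segment)
qed

lemma finite_unique_maximizer:
  fixes N :: "'a::real_inner set"
  assumes "finite N" "N \<noteq> {}" "\<And>a b. a \<in> N \<Longrightarrow> b \<in> N \<Longrightarrow> a \<noteq> b \<Longrightarrow> q \<bullet> (a - b) \<noteq> 0"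
  obtains a where "a \<in> N" "\<And>b. b \<in> N \<Longrightarrow> b \<noteq> a \<Longrightarrow> q \<bullet> b < q \<bullet> a"
    "\<And>m. m \<in> convex hull N \<Longrightarrow> q \<bullet> m \<le> q \<bullet> a"
proof -
  have "Max ((\<bullet>) q ` N) \<in> (\<bullet>) q ` N" using assms by (intro Max_in) auto
  then obtain a where a: "a \<in> N" "Max ((\<bullet>) q ` N) = q \<bullet> a" by auto
  have le: "q \<bullet> b \<le> q \<bullet> a" if "b \<in> N" for b
    using that a(2) assms(1) by (metis Max_ge finite_imageI imageI)
  show ?thesis
  proof (rule that[OF a(1)])
    show "q \<bullet> b < q \<bullet> a" if "b \<in> N" "b \<noteq> a" for b
      using le[OF that(1)] assms(3)[OF a(1) that(1)] that(2) by (auto simp: inner_diff_right)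
    have "convex hull N \<subseteq> {x. q \<bullet> x \<le> q \<bullet> a}"
      using le by (intro hull_minimal convex_halfspace_le) auto
    then show "q \<bullet> m \<le> q \<bullet> a" if "m \<in> convex hull N" for m using that by auto
  qed
qed

text \<open>Suppose the element \<open>g\<close> were separated from the subdifferential by a direction \<open>q\<close>. Perturbed
  to be generic, \<open>q\<close> is maximized over the nearest points of \<open>z\<close> in \<open>A\<^sub>i\<close> at a single \<open>a\<^sub>i\<close>. This
  \<open>a\<^sub>i\<close> is the unique nearest point of \<open>z + e q\<close> for small \<open>e > 0\<close>, which exhibits
  \<open>2 (z - lam a\<^sub>1 - (1 - lam) a\<^sub>2)\<close> as a limiting gradient on the wrong side of the hyperplane.\<close>

lemma clarke_subdifferential_geometric_potential:
  fixes A1 A2 :: "'a::euclidean_space set"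
  assumes A: "finite A1" "A1 \<noteq> {}" "finite A2" "A2 \<noteq> {}" and lam: "0 \<le> lam" "lam \<le> 1"
    and m1: "m1 \<in> convex hull (nearest_points A1 z)" and m2: "m2 \<in> convex hull (nearest_points A2 z)"
  shows "2 *\<^sub>R (z - lam *\<^sub>R m1 - (1 - lam) *\<^sub>R m2) \<in> clarke_subdifferential (geometric_potential lam A1 A2) z"
    (is "?g \<in> _")
proof -
  let ?\<Phi> = "geometric_potential lam A1 A2"
  define L where "L = {v. \<exists>s :: nat \<Rightarrow> 'a. s \<longlonglongrightarrow> z \<and> (\<forall>k. ?\<Phi> differentiable at (s k)) \<and>
           (\<lambda>k. gradient ?\<Phi> (s k)) \<longlonglongrightarrow> v}"
  define vtx where "vtx = (\<lambda>(a, b). 2 *\<^sub>R (z - lam *\<^sub>R a - (1 - lam) *\<^sub>R b))"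
  define N1 N2 where "N1 = nearest_points A1 z" and "N2 = nearest_points A2 z"
  have N: "finite N1" "N1 \<noteq> {}" "finite N2" "N2 \<noteq> {}" "N1 \<subseteq> A1" "N2 \<subseteq> A2"
    using A nearest_points_nonempty[of A1 z] nearest_points_nonempty[of A2 z]
    by (auto simp: N1_def N2_def nearest_points_def finite_imp_closed)
  \<comment> \<open>Keeping only those candidate vertices that are limiting gradients gives a finite
    set, whose hull is compact as the separation argument requires.\<close>
  define P where "P = vtx ` (N1 \<times> N2) \<inter> L"
  have P: "finite P" using N by (simp add: P_def)
  have "?g \<in> convex hull P"
  proof (rule ccontr)
    assume ng: "?g \<notin> convex hull P"
    \<comment> \<open>A direction not orthogonal to any of these differences takes distinct values
      at distinct points of \<open>A1\<close>, and likewise of \<open>A2\<close>.\<close>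
    let ?W = "(\<lambda>(a, b). a - b) ` ((A1 \<times> A1) \<union> (A2 \<times> A2)) - {0}"
    have cl: "closure {q. \<forall>w\<in>?W. q \<bullet> w \<noteq> 0} = UNIV"
      using A by (intro closure_generic_directions) auto
    obtain q b where q: "q \<in> {q. \<forall>w\<in>?W. q \<bullet> w \<noteq> 0}" "q \<bullet> ?g < b"
      "\<And>x. x \<in> convex hull P \<Longrightarrow> b < q \<bullet> x"
      by (rule separation_dense[OF convex_convex_hull finite_imp_compact_convex_hull[OF P] ng cl]) blast
    have gen: "q \<bullet> (x - y) \<noteq> 0" if "x \<noteq> y" "x \<in> A1 \<and> y \<in> A1 \<or> x \<in> A2 \<and> y \<in> A2" for x y
    proof -
      have "x - y \<in> ?W" using that by force
      then show ?thesis using q(1) by blast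
    qed
    obtain a1 where a1: "a1 \<in> N1" "\<And>b. b \<in> N1 \<Longrightarrow> b \<noteq> a1 \<Longrightarrow> q \<bullet> b < q \<bullet> a1"
        "\<And>m. m \<in> convex hull N1 \<Longrightarrow> q \<bullet> m \<le> q \<bullet> a1"
      using finite_unique_maximizer[OF N(1,2), of q] gen N(5) by (metis subsetD)
    obtain a2 where a2: "a2 \<in> N2" "\<And>b. b \<in> N2 \<Longrightarrow> b \<noteq> a2 \<Longrightarrow> q \<bullet> b < q \<bullet> a2"
        "\<And>m. m \<in> convex hull N2 \<Longrightarrow> q \<bullet> m \<le> q \<bullet> a2"
      using finite_unique_maximizer[OF N(3,4), of q] gen N(6) by (metis subsetD)
    define s where "s k = z + (1 / real (Suc k)) *\<^sub>R q" for k
    have e0: "filterlim (\<lambda>k. 1 / real (Suc k)) (at_right 0) sequentially"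
      unfolding filterlim_at using LIMSEQ_Suc[OF lim_1_over_n] by auto
    have "(\<lambda>k. 1 / real (Suc k)) \<longlonglongrightarrow> 0"
      using LIMSEQ_Suc[OF lim_1_over_n] .
    then have "s \<longlonglongrightarrow> z + 0 *\<^sub>R q"
      unfolding s_def by (intro tendsto_intros)
    then have sz: "s \<longlonglongrightarrow> z" by simp
    have ev1: "\<forall>\<^sub>F k in sequentially. \<forall>b\<in>A1 - {a1}. dist (s k) a1 < dist (s k) b"
      unfolding s_def using a1 A
      by (intro eventually_compose_filterlim[OF eventually_nearest_in_direction e0]) (auto simp: N1_def)
    have ev2: "\<forall>\<^sub>F k in sequentially. \<forall>b\<in>A2 - {a2}. dist (s k) a2 < dist (s k) b"
      unfolding s_def using a2 A
      by (intro eventually_compose_filterlim[OF eventually_nearest_in_direction e0]) (auto simp: N2_def)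
    let ?D = "\<lambda>y. lam *\<^sub>R (2 *\<^sub>R (y - a1)) + (1 - lam) *\<^sub>R (2 *\<^sub>R (y - a2))"
    have gd: "\<forall>\<^sub>F k in sequentially. GDERIV ?\<Phi> (s k) :> ?D (s k)"
      using ev1 ev2
    proof eventually_elim
      case (elim k)
      have d1: "GDERIV (\<lambda>x. (infdist x A1)\<^sup>2) (s k) :> 2 *\<^sub>R (s k - a1)"
        using elim(1) a1(1) A N by (intro GDERIV_infdist_square) auto
      have d2: "GDERIV (\<lambda>x. (infdist x A2)\<^sup>2) (s k) :> 2 *\<^sub>R (s k - a2)"
        using elim(2) a2(1) A N by (intro GDERIV_infdist_square) auto
      show ?case
        using has_derivative_add[OF has_derivative_mult_right[OF d1[unfolded gderiv_def], of lam]
            has_derivative_mult_right[OF d2[unfolded gderiv_def], of "1 - lam"]]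
        unfolding gderiv_def geometric_potential_def by (simp only: inner_add_right inner_scaleR_right)
    qed
    have "(\<lambda>k. ?D (s k)) \<longlonglongrightarrow> ?D z"
      by (intro tendsto_intros sz)
    also have "?D z = vtx (a1, a2)"
      by (simp add: vtx_def algebra_simps)
    finally have "vtx (a1, a2) \<in> L"
      unfolding L_def using limiting_gradientI[OF sz gd] by blast
    then have "vtx (a1, a2) \<in> P" using a1(1) a2(1) by (auto simp: P_def)
    then have "b < q \<bullet> vtx (a1, a2)" by (intro q(3) hull_inc)
    \<comment> \<open>Here \<open>0 \<le> lam \<le> 1\<close> enters: with both coefficients
      nonnegative, maximizing \<open>q\<close> over each set of nearest points separately minimizes
      \<open>q\<close> over the vertices.\<close>
    moreover have "q \<bullet> vtx (a1, a2) \<le> q \<bullet> ?g"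
    proof -
      have "lam * (q \<bullet> m1) \<le> lam * (q \<bullet> a1)" "(1 - lam) * (q \<bullet> m2) \<le> (1 - lam) * (q \<bullet> a2)"
        using lam m1 m2 a1(3) a2(3) by (auto intro!: mult_left_mono simp: N1_def N2_def)
      then show ?thesis by (simp add: vtx_def inner_diff_right)
    qed
    ultimately show False using q(2) by simp
  qed
  also have "\<dots> \<subseteq> convex hull L" by (intro hull_mono) (auto simp: P_def)
  finally show ?thesis by (simp add: clarke_subdifferential_def L_def)
qed

text \<open>The case \<open>lam = 1\<close> of the geometric potential with both sets equal to
  \<open>A\<close>.\<close>

lemma clarke_subdifferential_infdist_square:
  fixes A :: "'a::euclidean_space set"
  assumes A: "finite A" "A \<noteq> {}" and m: "m \<in> convex hull (nearest_points A z)"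
  shows "2 *\<^sub>R (z - m) \<in> clarke_subdifferential (\<lambda>z. (infdist z A)\<^sup>2) z"
proof -
  have eq: "geometric_potential 1 A A = (\<lambda>z. (infdist z A)\<^sup>2)"
    by (simp add: geometric_potential_def fun_eq_iff)
  have "2 *\<^sub>R (z - 1 *\<^sub>R m - (1 - 1) *\<^sub>R m) \<in> clarke_subdifferential (geometric_potential 1 A A) z"
    by (rule clarke_subdifferential_geometric_potential[OF A A _ _ m m]) auto
  then show ?thesis unfolding eq by simp
qed

section \<open>Heat flow of a finite Dirac mixture\<close>

text \<open>\<open>\<mu>\<close> is the image under \<open>a\<close> of the weights regarded as a
  measure on the indices, which also handles repeated points.\<close>

lemma integral_dirac_sum:
  fixes a :: "nat \<Rightarrow> 'a::euclidean_space" and w :: "nat \<Rightarrow> real" and f :: "'a \<Rightarrow> real"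
  assumes sets: "sets \<mu> = sets borel" and w: "\<forall>k<n. w k > 0"
    and \<mu>: "\<forall>B\<in>sets borel. emeasure \<mu> B = (\<Sum>k<n. ennreal (w k) * emeasure (return borel (a k)) B)"
    and f: "f \<in> borel_measurable borel"
  shows "(LINT y|\<mu>. f y) = (\<Sum>k<n. w k * f (a k))"
proof -
  let ?P = "point_measure {..<n} (\<lambda>k. ennreal (w k))"
  have a: "a \<in> ?P \<rightarrow>\<^sub>M borel" by (simp add: measurable_point_measure_eq1)
  have "\<mu> = distr ?P borel a"
  proof (rule measure_eqI)
    show "sets \<mu> = sets (distr ?P borel a)" using sets by simp
    fix B assume "B \<in> sets \<mu>"
    then have B: "B \<in> sets borel" using sets by simp
    have "emeasure (distr ?P borel a) B = (\<Sum>k\<in>a -` B \<inter> {..<n}. ennreal (w k))"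
      using a B by (simp add: emeasure_distr space_point_measure emeasure_point_measure_finite2)
    also have "\<dots> = (\<Sum>k<n. ennreal (w k) * emeasure (return borel (a k)) B)"
      using B by (intro sum.mono_neutral_cong_left) (auto simp: indicator_def)
    finally show "emeasure \<mu> B = emeasure (distr ?P borel a) B" using \<mu> B by simp
  qed
  then have "(LINT y|\<mu>. f y) = (LINT k|?P. f (a k))"
    using integral_distr[OF a f] by simp
  also have "\<dots> = (\<Sum>k<n. w k * f (a k))"
    using w by (subst lebesgue_integral_point_measure_finite) (auto intro: less_imp_le)
  finally show ?thesis .
qed

text \<open>The heat kernel without its prefactor, which depends on \<open>t\<close> alone and
  cancels in the normalized weights.\<close>

definition gibbs_weight :: "(nat \<Rightarrow> 'a::euclidean_space) \<Rightarrow> (nat \<Rightarrow> real) \<Rightarrow> 'a \<Rightarrow> real \<Rightarrow> nat \<Rightarrow> real" where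
  "gibbs_weight a w x t k = w k * exp (- (norm (x - a k))\<^sup>2 / (4 * t))"

definition gibbs_mean :: "nat \<Rightarrow> (nat \<Rightarrow> 'a::euclidean_space) \<Rightarrow> (nat \<Rightarrow> real) \<Rightarrow> 'a \<Rightarrow> real \<Rightarrow> 'a" where
  "gibbs_mean n a w x t =
     (\<Sum>k<n. (gibbs_weight a w x t k / (\<Sum>l<n. gibbs_weight a w x t l)) *\<^sub>R a k)"

section \<open>Gibbs weights, the score they produce, and their concentration as \<open>t\<close>
  tends to 0\<close>

lemma gibbs_weight_pos: "w k > 0 \<Longrightarrow> gibbs_weight a w x t k > 0"
  by (simp add: gibbs_weight_def)

lemma gibbs_weight_sum_pos:
  assumes "n \<ge> 1" "\<forall>k<n. w k > 0"
  shows "(\<Sum>l<n. gibbs_weight a w x t l) > 0"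
  using assms by (intro sum_pos gibbs_weight_pos) (auto simp: lessThan_empty_iff)

lemma gibbs_weights_normalized_nonneg:
  assumes "n \<ge> 1" "\<forall>k<n. w k > 0" "k < n"
  shows "gibbs_weight a w x t k / (\<Sum>l<n. gibbs_weight a w x t l) \<ge> 0"
  using gibbs_weight_sum_pos[OF assms(1,2)] gibbs_weight_pos[of w k] assms(2,3)
  by (intro divide_nonneg_pos less_imp_le) auto

lemma gibbs_weights_normalized:
  assumes "n \<ge> 1" "\<forall>k<n. w k > 0"
  shows "(\<Sum>k<n. gibbs_weight a w x t k / (\<Sum>l<n. gibbs_weight a w x t l)) = 1"
  using gibbs_weight_sum_pos[OF assms, of a x t] by (simp flip: sum_divide_distrib)

lemma gibbs_mean_in_hull:
  assumes "n \<ge> 1" "\<forall>k<n. w k > 0"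
  shows "gibbs_mean n a w x t \<in> convex hull (a ` {..<n})"
  unfolding gibbs_mean_def
  by (intro convex_sum gibbs_weights_normalized[OF assms] gibbs_weights_normalized_nonneg[OF assms])
    (auto intro!: hull_inc)

text \<open>Differentiating the exponentials produces the factors
  \<open>- (x - a k) / (2 * t)\<close>, and the logarithmic derivative averages them with the
  normalized weights. The constant \<open>C\<close> stands for the prefactor of the heat kernel and
  drops out.\<close>

lemma GDERIV_ln_gibbs_sum:
  fixes a :: "nat \<Rightarrow> 'a::euclidean_space"
  assumes n: "n \<ge> 1" "\<forall>k<n. w k > 0" and t: "t > 0" and C: "C > 0"
  shows "GDERIV (\<lambda>x. ln (C * (\<Sum>k<n. gibbs_weight a w x t k))) x
           :> - ((1 / (2 * t)) *\<^sub>R (x - gibbs_mean n a w x t))"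
proof -
  let ?S = "\<lambda>x. \<Sum>k<n. gibbs_weight a w x t k"
  have S: "?S x > 0" using n by (rule gibbs_weight_sum_pos)
  have dk: "((\<lambda>x. gibbs_weight a w x t k) has_derivative
      (\<lambda>h. gibbs_weight a w x t k * (- (h \<bullet> (x - a k)) / (2 * t)))) (at x)" for k
    unfolding gibbs_weight_def power2_norm_eq_inner
    using t by (auto intro!: derivative_eq_intros simp: inner_commute field_simps fun_eq_iff)
  have "(?S has_derivative (\<lambda>h. \<Sum>k<n. gibbs_weight a w x t k * (- (h \<bullet> (x - a k)) / (2 * t)))) (at x)"
    by (intro has_derivative_sum dk)
  then have "((\<lambda>x. C * ?S x) has_derivative
      (\<lambda>h. C * (\<Sum>k<n. gibbs_weight a w x t k * (- (h \<bullet> (x - a k)) / (2 * t))))) (at x)"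
    by (rule has_derivative_mult_right)
  then have "((\<lambda>x. ln (C * ?S x)) has_derivative
      (\<lambda>h. (C * (\<Sum>k<n. gibbs_weight a w x t k * (- (h \<bullet> (x - a k)) / (2 * t)))) * inverse (C * ?S x))) (at x)"
    using S C by (intro has_derivative_ln) auto
  moreover have "(C * (\<Sum>k<n. gibbs_weight a w x t k * (- (h \<bullet> (x - a k)) / (2 * t)))) * inverse (C * ?S x)
      = h \<bullet> - ((1 / (2 * t)) *\<^sub>R (x - gibbs_mean n a w x t))" for h
  proof -
    have "(\<Sum>k<n. gibbs_weight a w x t k * (- (h \<bullet> (x - a k)) / (2 * t)))
        = (\<Sum>k<n. gibbs_weight a w x t k * (h \<bullet> a k) / (2 * t) - gibbs_weight a w x t k * (h \<bullet> x) / (2 * t))"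
      using t by (intro sum.cong) (auto simp: inner_diff_right field_simps)
    also have "\<dots> = ((\<Sum>k<n. gibbs_weight a w x t k * (h \<bullet> a k)) - ?S x * (h \<bullet> x)) / (2 * t)"
      by (simp add: sum_subtractf sum_divide_distrib sum_distrib_right diff_divide_distrib)
    also have "(\<Sum>k<n. gibbs_weight a w x t k * (h \<bullet> a k)) = ?S x * (h \<bullet> gibbs_mean n a w x t)"
      using S by (simp add: gibbs_mean_def inner_sum_right sum_distrib_left)
    finally show ?thesis
      using S C t by (simp add: inner_diff_right field_simps)
  qed
  ultimately show ?thesis by (simp add: gderiv_def)
qed

text \<open>The denominator is at least the weight of the closer point \<open>i\<close>, leaving
  \<open>exp\<close> of minus a quantity with positive limit divided by \<open>4 * t\<close>. The
  product filter makes the limit joint in position and time, because the trajectory moves while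
  \<open>t\<close> decreases.\<close>

lemma gibbs_weight_ratio_tendsto_0:
  fixes a :: "nat \<Rightarrow> 'a::euclidean_space"
  assumes n: "n \<ge> 1" "\<forall>k<n. w k > 0" and k: "k < n" "i < n" "dist z (a i) < dist z (a k)"
  shows "((\<lambda>p. gibbs_weight a w (fst p) (snd p) k / (\<Sum>l<n. gibbs_weight a w (fst p) (snd p) l)) \<longlongrightarrow> 0)
           (nhds z \<times>\<^sub>F at_right 0)"
proof -
  let ?F = "nhds z \<times>\<^sub>F at_right (0::real)"
  have f: "filterlim fst (nhds z) ?F" and s: "filterlim snd (at_right 0) ?F"
    by (rule filterlim_fst filterlim_snd)+
  let ?c = "\<lambda>y. (norm (y - a k))\<^sup>2 - (norm (y - a i))\<^sup>2"
  have c: "?c z > 0" using k(3) by (simp add: dist_norm power_strict_mono)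
  have "filterlim (\<lambda>p. ?c (fst p) * inverse (snd p)) at_top ?F"
  proof (rule filterlim_tendsto_pos_mult_at_top[OF _ c])
    show "((\<lambda>p. ?c (fst p)) \<longlongrightarrow> ?c z) ?F" by (intro tendsto_intros f)
    show "filterlim (\<lambda>p. inverse (snd p)) at_top ?F"
      by (rule filterlim_compose[OF filterlim_inverse_at_top_right s])
  qed
  then have "filterlim (\<lambda>p. (1 / 4) * (?c (fst p) * inverse (snd p))) at_top ?F"
    by (intro filterlim_tendsto_pos_mult_at_top[OF tendsto_const]) auto
  then have "filterlim (\<lambda>p. - ((1 / 4) * (?c (fst p) * inverse (snd p)))) at_bot ?F"
    by (simp add: filterlim_uminus_at_bot)
  then have "((\<lambda>p. exp (- ((1 / 4) * (?c (fst p) * inverse (snd p))))) \<longlongrightarrow> 0) ?F"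
    by (rule filterlim_compose[OF exp_at_bot])
  then have lim: "((\<lambda>p. (w k / w i) * exp (- ((1 / 4) * (?c (fst p) * inverse (snd p))))) \<longlongrightarrow> 0) ?F"
    by (rule tendsto_mult_right_zero)
  show ?thesis
  proof (rule tendsto_sandwich[OF _ _ tendsto_const lim]; intro always_eventually allI)
    fix p :: "'a \<times> real"
    obtain y t where p: "p = (y, t)" by (cases p)
    have S: "(\<Sum>l<n. gibbs_weight a w y t l) > 0" using n by (rule gibbs_weight_sum_pos)
    have kp: "gibbs_weight a w y t k > 0" and ip: "gibbs_weight a w y t i > 0"
      using n k by (auto intro: gibbs_weight_pos)
    show "0 \<le> gibbs_weight a w (fst p) (snd p) k / (\<Sum>l<n. gibbs_weight a w (fst p) (snd p) l)"
      using S kp by (simp add: p)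
    have "gibbs_weight a w y t i \<le> (\<Sum>l<n. gibbs_weight a w y t l)"
      using n k(2) by (intro member_le_sum) (auto intro: less_imp_le gibbs_weight_pos)
    then have "gibbs_weight a w y t k / (\<Sum>l<n. gibbs_weight a w y t l) \<le> gibbs_weight a w y t k / gibbs_weight a w y t i"
      using S kp ip by (intro divide_left_mono) auto
    also have "\<dots> = (w k / w i) * exp (- ((1 / 4) * (?c y * inverse t)))"
    proof -
      have "exp (- (norm (y - a k))\<^sup>2 / (4 * t)) / exp (- (norm (y - a i))\<^sup>2 / (4 * t))
          = exp (- (norm (y - a k))\<^sup>2 / (4 * t) - (- (norm (y - a i))\<^sup>2 / (4 * t)))"
        by (rule exp_diff[symmetric])
      also have "- (norm (y - a k))\<^sup>2 / (4 * t) - (- (norm (y - a i))\<^sup>2 / (4 * t))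
          = - ((1 / 4) * (?c y * inverse t))"
      proof -
        \<comment> \<open>The bound is stated for every \<open>p\<close>, including
          \<open>t = 0\<close>, where both sides vanish since division by zero yields 0.\<close>
        have "- N / (4 * t) - (- M / (4 * t)) = - ((1 / 4) * ((N - M) * inverse t))" for N M :: real
          by (cases "t = 0") (simp_all add: field_simps)
        then show ?thesis .
      qed
      finally show ?thesis unfolding gibbs_weight_def by (metis times_divide_times_eq)
    qed
    finally show "gibbs_weight a w (fst p) (snd p) k / (\<Sum>l<n. gibbs_weight a w (fst p) (snd p) l)
        \<le> (w k / w i) * exp (- ((1 / 4) * (?c (fst p) * inverse (snd p))))"
      by (simp add: p)
  qed
qed

text \<open>Moving the vanishing mass of the points that are not nearest to \<open>z\<close> onto a fixed nearest point
  yields an element of the convex hull of the nearest points.\<close>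

lemma gibbs_mean_near_nearest_hull:
  fixes a :: "nat \<Rightarrow> 'a::euclidean_space"
  assumes n: "n \<ge> 1" "\<forall>k<n. w k > 0" and e: "e > 0"
  shows "\<exists>r>0. \<forall>y t. dist y z < r \<longrightarrow> 0 < t \<longrightarrow> t < r \<longrightarrow>
     (\<exists>m\<in>convex hull (nearest_points (a ` {..<n}) z). norm (gibbs_mean n a w y t - m) < e)"
proof -
  let ?A = "a ` {..<n}"
  let ?N = "nearest_points ?A z"
  let ?F = "nhds z \<times>\<^sub>F at_right (0::real)"
  have "?A \<noteq> {}" using n(1) by (simp add: lessThan_empty_iff)
  then have "?N \<noteq> {}" by (intro nearest_points_nonempty finite_imp_closed) auto
  then obtain i where i: "i < n" "a i \<in> ?N" unfolding nearest_points_def by blast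
  define \<omega> where "\<omega> y t k = gibbs_weight a w y t k / (\<Sum>l<n. gibbs_weight a w y t l)" for y t k
  have \<omega>: "\<omega> y t k \<ge> 0" if "k < n" for y t k
    unfolding \<omega>_def using n that by (rule gibbs_weights_normalized_nonneg)
  define c where "c k = (if a k \<in> ?N then a k else a i)" for k
  have M: "(\<Sum>k<n. \<omega> y t k *\<^sub>R c k) \<in> convex hull ?N" for y t
    using gibbs_weights_normalized[OF n, of a y t] \<omega> i
    by (intro convex_sum) (auto simp: c_def \<omega>_def intro: hull_inc)
  have "((\<lambda>p. \<omega> (fst p) (snd p) k *\<^sub>R (a k - c k)) \<longlongrightarrow> 0) ?F" if k: "k < n" for k
  proof (cases "a k \<in> ?N")
    case True
    then show ?thesis by (simp add: c_def)
  next
    case False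
    have "dist z (a i) < dist z (a k)" using not_nearest_point_dist[OF _ False i(2)] k by simp
    from gibbs_weight_ratio_tendsto_0[OF n k i(1) this]
    have "((\<lambda>p. \<omega> (fst p) (snd p) k *\<^sub>R (a k - c k)) \<longlongrightarrow> 0 *\<^sub>R (a k - c k)) ?F"
      unfolding \<omega>_def by (intro tendsto_scaleR tendsto_const)
    then show ?thesis by simp
  qed
  then have "((\<lambda>p. \<Sum>k<n. \<omega> (fst p) (snd p) k *\<^sub>R (a k - c k)) \<longlongrightarrow> (\<Sum>k<n. 0)) ?F"
    by (intro tendsto_sum) auto
  then have "\<forall>\<^sub>F p in ?F. dist (\<Sum>k<n. \<omega> (fst p) (snd p) k *\<^sub>R (a k - c k)) 0 < e"
    using e by (simp add: tendsto_iff)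
  then obtain P Q where P: "\<forall>\<^sub>F y in nhds z. P y" and Q: "\<forall>\<^sub>F t in at_right 0. Q t"
    and PQ: "\<And>y t. P y \<Longrightarrow> Q t \<Longrightarrow> norm (\<Sum>k<n. \<omega> y t k *\<^sub>R (a k - c k)) < e"
    unfolding eventually_prod_filter by auto
  obtain r1 where r1: "r1 > 0" "\<And>y. dist y z < r1 \<Longrightarrow> P y"
    using P unfolding eventually_nhds_metric by blast
  obtain r2 where r2: "r2 > 0" "\<And>t. 0 < t \<Longrightarrow> t < r2 \<Longrightarrow> Q t"
    using Q unfolding eventually_at_right_field by blast
  show ?thesis
  proof (intro exI[of _ "min r1 r2"] conjI allI impI)
    show "min r1 r2 > 0" using r1 r2 by simp
    fix y t assume yt: "dist y z < min r1 r2" "0 < t" "t < min r1 r2"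
    have "gibbs_mean n a w y t - (\<Sum>k<n. \<omega> y t k *\<^sub>R c k) = (\<Sum>k<n. \<omega> y t k *\<^sub>R (a k - c k))"
      by (simp add: gibbs_mean_def \<omega>_def scaleR_diff_right sum_subtractf)
    then have "norm (gibbs_mean n a w y t - (\<Sum>k<n. \<omega> y t k *\<^sub>R c k)) < e"
      using PQ[OF r1(2) r2(2), of y t] yt by simp
    then show "\<exists>m\<in>convex hull ?N. norm (gibbs_mean n a w y t - m) < e" using M by blast
  qed
qed

text \<open>Hides the points and weights of the mixture: afterwards only its support and the mean
  \<open>m\<close> appear.\<close>

lemma finite_dirac_mixture_score:
  fixes \<mu> :: "'a::euclidean_space measure"
  assumes "finite_dirac_mixture \<mu>"
  obtains m :: "'a \<Rightarrow> real \<Rightarrow> 'a" where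
    "finite (measure_support \<mu>)" "measure_support \<mu> \<noteq> {}"
    "\<And>x t. m x t \<in> convex hull (measure_support \<mu>)"
    "\<And>x t. t > 0 \<Longrightarrow> GDERIV (\<lambda>x. ln (heat_flow \<mu> x t)) x :> - ((1 / (2 * t)) *\<^sub>R (x - m x t))"
    "\<And>z e. e > 0 \<Longrightarrow> \<exists>r>0. \<forall>y t. dist y z < r \<longrightarrow> 0 < t \<longrightarrow> t < r \<longrightarrow>
       (\<exists>c\<in>convex hull (nearest_points (measure_support \<mu>) z). norm (m y t - c) < e)"
proof -
  obtain n :: nat and a w where sets: "sets \<mu> = sets borel" and n: "n \<ge> 1" and w: "\<forall>k<n. w k > 0"
    and \<mu>: "\<forall>B\<in>sets borel. emeasure \<mu> B = (\<Sum>k<n. ennreal (w k) * emeasure (return borel (a k)) B)"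
    using assms unfolding finite_dirac_mixture_def by blast
  have supp: "measure_support \<mu> = a ` {..<n}"
    using w \<mu> by (rule measure_support_dirac_mixture)
  have hf: "heat_flow \<mu> x t = (4 * pi * t) powr (- real DIM('a) / 2) * (\<Sum>k<n. gibbs_weight a w x t k)" for x t
  proof -
    have "heat_flow \<mu> x t = (\<Sum>k<n. w k * heat_kernel t (x - a k))"
      unfolding heat_flow_def
      by (rule integral_dirac_sum[OF sets w \<mu>]) (unfold heat_kernel_def, measurable)
    then show ?thesis
      by (simp add: heat_kernel_def gibbs_weight_def sum_distrib_left mult_ac)
  qed
  show ?thesis
  proof (rule that[of "gibbs_mean n a w"])
    show "finite (measure_support \<mu>)" "measure_support \<mu> \<noteq> {}"
      using n by (auto simp: supp lessThan_empty_iff)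
    show "gibbs_mean n a w x t \<in> convex hull (measure_support \<mu>)" for x t
      using n w by (simp add: supp gibbs_mean_in_hull)
    show "GDERIV (\<lambda>x. ln (heat_flow \<mu> x t)) x :> - ((1 / (2 * t)) *\<^sub>R (x - gibbs_mean n a w x t))"
      if "t > 0" for x t
      unfolding hf using that by (intro GDERIV_ln_gibbs_sum n w) auto
    show "\<exists>r>0. \<forall>y t. dist y z < r \<longrightarrow> 0 < t \<longrightarrow> t < r \<longrightarrow>
       (\<exists>c\<in>convex hull (nearest_points (measure_support \<mu>) z). norm (gibbs_mean n a w y t - c) < e)"
      if "e > 0" for z e
      unfolding supp using n w that by (rule gibbs_mean_near_nearest_hull)
  qed
qed

section \<open>The rescaled generation equation\<close>

text \<open>With the integrating factor \<open>exp (t / 2)\<close> the derivative of the product is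
  \<open>(exp (t / 2) / 2) *\<^sub>R u t\<close>, whose norm is at most the derivative of
  \<open>B * exp (t / 2)\<close>.\<close>

lemma relaxation_bounded:
  fixes Y u :: "real \<Rightarrow> 'a::euclidean_space"
  assumes deriv: "\<And>t. t \<ge> 0 \<Longrightarrow> (Y has_vector_derivative (- 1 / 2) *\<^sub>R (Y t - u t)) (at t within {0..})"
    and u: "\<And>t. t \<ge> 0 \<Longrightarrow> norm (u t) \<le> B" and t: "t \<ge> 0"
  shows "norm (Y t) \<le> norm (Y 0) + B"
proof (cases "t = 0")
  case True
  have "0 \<le> norm (u 0)" by simp
  also have "\<dots> \<le> B" by (rule u) simp
  finally show ?thesis using True by simp
next
  case False
  with t have t: "0 < t" by simp
  have B: "B \<ge> 0" using u[of 0] norm_ge_zero[of "u 0"] by linarith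
  have d: "((\<lambda>s. exp (s / 2) *\<^sub>R Y s) has_vector_derivative (exp (s / 2) / 2) *\<^sub>R u s) (at s within {0..})"
    if "s \<ge> 0" for s
  proof -
    have "((\<lambda>s. exp (s / 2)) has_field_derivative exp (s / 2) / 2) (at s within {0..})"
      by (auto intro!: derivative_eq_intros)
    from has_vector_derivative_scaleR[OF this deriv[OF that]]
    show ?thesis by (simp add: algebra_simps)
  qed
  have "norm (exp (t / 2) *\<^sub>R Y t - exp (0 / 2) *\<^sub>R Y 0) \<le> B * exp (t / 2) - B * exp (0 / 2)"
  proof (rule differentiable_bound_general[OF t])
    show "continuous_on {0..t} (\<lambda>s. exp (s / 2) *\<^sub>R Y s)"
      by (rule continuous_on_vector_derivative, rule has_vector_derivative_within_subset[OF d]) auto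
    show "continuous_on {0..t} (\<lambda>s. B * exp (s / 2))" by (intro continuous_intros) auto
    fix s assume s: "0 < s" "s < t"
    show "((\<lambda>s. exp (s / 2) *\<^sub>R Y s) has_vector_derivative (exp (s / 2) / 2) *\<^sub>R u s) (at s)"
      using d[of s] s at_within_interior[of s "{0::real..}"] by simp
    show "((\<lambda>s. B * exp (s / 2)) has_vector_derivative B * exp (s / 2) / 2) (at s)"
      unfolding has_real_derivative_iff_has_vector_derivative[symmetric]
      by (auto intro!: derivative_eq_intros)
    show "norm ((exp (s / 2) / 2) *\<^sub>R u s) \<le> B * exp (s / 2) / 2"
      using u[of s] s by simp
  qed
  then have "norm (exp (t / 2) *\<^sub>R Y t - Y 0) \<le> B * exp (t / 2) - B" by simp
  then have "exp (t / 2) * norm (Y t) \<le> norm (Y 0) + (B * exp (t / 2) - B)"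
    using norm_triangle_sub[of "exp (t / 2) *\<^sub>R Y t" "Y 0"] by simp
  also have "\<dots> \<le> exp (t / 2) * (norm (Y 0) + B)"
  proof -
    have "1 * norm (Y 0) \<le> exp (t / 2) * norm (Y 0)"
      using t by (intro mult_right_mono) auto
    then show ?thesis using B by (simp add: algebra_simps)
  qed
  finally show ?thesis by simp
qed

lemma vector_derivative_bounded_imp_lipschitz:
  fixes Y v :: "real \<Rightarrow> 'a::euclidean_space"
  assumes deriv: "\<And>t. t \<in> S \<Longrightarrow> (Y has_vector_derivative v t) (at t within S)"
    and v: "\<And>t. t \<in> S \<Longrightarrow> norm (v t) \<le> L" and "convex S" "L \<ge> 0"
  shows "L-lipschitz_on S Y"
proof (rule lipschitz_onI)
  fix x y assume "x \<in> S" "y \<in> S"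
  then have "norm (Y x - Y y) \<le> L * norm (x - y)"
  proof (intro differentiable_bound[OF \<open>convex S\<close>, of Y "\<lambda>t h. h *\<^sub>R v t"])
    fix t assume t: "t \<in> S"
    then show "(Y has_derivative (\<lambda>h. h *\<^sub>R v t)) (at t within S)"
      using deriv unfolding has_vector_derivative_def by blast
    show "onorm (\<lambda>h. h *\<^sub>R v t) \<le> L"
    proof (rule onorm_le)
      fix h :: real
      show "norm (h *\<^sub>R v t) \<le> L * norm h"
        using mult_left_mono[OF v[OF t], of "\<bar>h\<bar>"] by (simp add: mult.commute)
    qed
  qed auto
  then show "dist (Y x) (Y y) \<le> L * dist x y" by (simp add: dist_norm)
qed (rule \<open>L \<ge> 0\<close>)

section \<open>The limiting velocity field and its inclusion in the Clarke fields\<close>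

lemma caratheodory_solution_mono:
  assumes "caratheodory_solution F z0 Z" "\<And>z. F z \<subseteq> F' z"
  shows "caratheodory_solution F' z0 Z"
proof -
  have "AE \<tau> in lebesgue_on {0..}. \<xi> \<tau> \<in> F' (Z \<tau>)"
    if "AE \<tau> in lebesgue_on {0..}. \<xi> \<tau> \<in> F (Z \<tau>)" for \<xi>
    using that by (rule eventually_mono) (use assms(2) in blast)
  then show ?thesis
    using assms(1) unfolding caratheodory_solution_def by meson
qed

text \<open>One field for both ranges of \<open>lam\<close>: the limit argument is carried out once,
  and the two Clarke fields are reached by inclusion.\<close>

definition nearest_hull_field :: "real \<Rightarrow> 'a::euclidean_space set \<Rightarrow> 'a set \<Rightarrow> 'a \<Rightarrow> 'a set" where
  "nearest_hull_field lam A1 A2 z = {(- 1 / 2) *\<^sub>R (z - lam *\<^sub>R m1 - (1 - lam) *\<^sub>R m2) | m1 m2.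
     m1 \<in> convex hull (nearest_points A1 z) \<and> m2 \<in> convex hull (nearest_points A2 z)}"

text \<open>Each value is an affine image of a product of two hulls of finite sets, hence convex and
  compact.\<close>

lemma nearest_hull_field_convex_closed:
  assumes "finite A1" "finite A2"
  shows "convex (nearest_hull_field lam A1 A2 z)" "closed (nearest_hull_field lam A1 A2 z)"
proof -
  let ?H = "(convex hull (nearest_points A1 z)) \<times> (convex hull (nearest_points A2 z))"
  define f where "f = (\<lambda>(x, y). (lam / 2) *\<^sub>R x + ((1 - lam) / 2) *\<^sub>R (y :: 'a))"
  have lin: "linear f"
    by (rule linearI) (auto simp: f_def algebra_simps)
  have "(- 1 / 2) *\<^sub>R (z - lam *\<^sub>R m1 - (1 - lam) *\<^sub>R m2) = (- 1 / 2) *\<^sub>R z + f (m1, m2)" for m1 m2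
    by (simp add: f_def scaleR_diff_right)
  then have eq: "nearest_hull_field lam A1 A2 z = (\<lambda>p. (- 1 / 2) *\<^sub>R z + p) ` f ` ?H"
    unfolding nearest_hull_field_def image_image by force
  have fin: "finite (nearest_points A1 z)" "finite (nearest_points A2 z)"
    using assms by (auto simp: nearest_points_def)
  show "convex (nearest_hull_field lam A1 A2 z)"
    unfolding eq by (intro convex_translation convex_linear_image lin convex_Times convex_convex_hull)
  have "compact ?H" using fin by (intro compact_Times finite_imp_compact_convex_hull)
  then have "compact ((\<lambda>p. (- 1 / 2) *\<^sub>R z + p) ` f ` ?H)"
    by (intro compact_translation compact_continuous_image linear_continuous_on linear_conv_bounded_linear[THEN iffD1] lin)
  then show "closed (nearest_hull_field lam A1 A2 z)"
    unfolding eq by (rule compact_imp_closed)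
qed

lemma nearest_hull_field_subset_clarke:
  assumes "finite A1" "A1 \<noteq> {}" "finite A2" "A2 \<noteq> {}" "0 \<le> lam" "lam \<le> 1"
  shows "nearest_hull_field lam A1 A2 z
    \<subseteq> (\<lambda>v. (- 1 / 4) *\<^sub>R v) ` clarke_subdifferential (geometric_potential lam A1 A2) z"
proof
  fix v assume "v \<in> nearest_hull_field lam A1 A2 z"
  then obtain m1 m2 where m: "m1 \<in> convex hull (nearest_points A1 z)" "m2 \<in> convex hull (nearest_points A2 z)"
    and v: "v = (- 1 / 2) *\<^sub>R (z - lam *\<^sub>R m1 - (1 - lam) *\<^sub>R m2)"
    by (auto simp: nearest_hull_field_def)
  have "v = (- 1 / 4) *\<^sub>R (2 *\<^sub>R (z - lam *\<^sub>R m1 - (1 - lam) *\<^sub>R m2))"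
    unfolding v scaleR_scaleR by simp
  then show "v \<in> (\<lambda>v. (- 1 / 4) *\<^sub>R v) ` clarke_subdifferential (geometric_potential lam A1 A2) z"
    using clarke_subdifferential_geometric_potential[OF assms m] by (rule image_eqI)
qed

text \<open>The Minkowski sum decouples the two squared distances, so each hull is treated on its
  own and the sign of \<open>1 - lam\<close> never enters.\<close>

lemma nearest_hull_field_subset_outer_clarke:
  assumes "finite A1" "A1 \<noteq> {}" "finite A2" "A2 \<noteq> {}"
  shows "nearest_hull_field lam A1 A2 z
    \<subseteq> (\<lambda>v. (- 1 / 4) *\<^sub>R v) ` outer_clarke_subdifferential lam A1 A2 z"
proof
  fix v assume "v \<in> nearest_hull_field lam A1 A2 z"
  then obtain m1 m2 where m: "m1 \<in> convex hull (nearest_points A1 z)" "m2 \<in> convex hull (nearest_points A2 z)"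
    and v: "v = (- 1 / 2) *\<^sub>R (z - lam *\<^sub>R m1 - (1 - lam) *\<^sub>R m2)"
    by (auto simp: nearest_hull_field_def)
  let ?w = "lam *\<^sub>R (2 *\<^sub>R (z - m1)) + (1 - lam) *\<^sub>R (2 *\<^sub>R (z - m2))"
  have w: "?w = 2 *\<^sub>R (z - lam *\<^sub>R m1 - (1 - lam) *\<^sub>R m2)"
    by (simp add: algebra_simps)
  have "v = (- 1 / 4) *\<^sub>R (2 *\<^sub>R (z - lam *\<^sub>R m1 - (1 - lam) *\<^sub>R m2))"
    unfolding v scaleR_scaleR by simp
  then have "v = (- 1 / 4) *\<^sub>R ?w" by (simp only: w)
  moreover have "?w \<in> outer_clarke_subdifferential lam A1 A2 z"
    unfolding outer_clarke_subdifferential_def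
    using clarke_subdifferential_infdist_square[OF assms(1,2) m(1)]
      clarke_subdifferential_infdist_square[OF assms(3,4) m(2)] by blast
  ultimately show "v \<in> (\<lambda>v. (- 1 / 4) *\<^sub>R v) ` outer_clarke_subdifferential lam A1 A2 z"
    by (rule image_eqI)
qed

text \<open>The substitution \<open>t = T * exp (- \<tau>)\<close> has derivative
  \<open>- t\<close>, which cancels the singular factor \<open>1 / (2 * t)\<close>.\<close>

lemma generation_solution_rescaled:
  fixes X :: "real \<Rightarrow> 'a::euclidean_space"
  assumes X: "\<And>t. t \<in> {0<..T} \<Longrightarrow> (X has_vector_derivative (1 / (2 * t)) *\<^sub>R (X t - u t)) (at t within {0<..T})"
    and T: "T > 0" and \<tau>: "\<tau> \<ge> 0"
  shows "((\<lambda>\<tau>. X (T * exp (- \<tau>))) has_vector_derivative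
      (- 1 / 2) *\<^sub>R (X (T * exp (- \<tau>)) - u (T * exp (- \<tau>)))) (at \<tau> within {0..})"
proof -
  let ?t = "\<lambda>\<tau>. T * exp (- \<tau>)"
  have t: "?t ` {0..} \<subseteq> {0<..T}" using T by auto
  have "(?t has_vector_derivative - ?t \<tau>) (at \<tau> within {0..})"
    unfolding has_real_derivative_iff_has_vector_derivative[symmetric]
    by (auto intro!: derivative_eq_intros)
  moreover have "(X has_vector_derivative (1 / (2 * ?t \<tau>)) *\<^sub>R (X (?t \<tau>) - u (?t \<tau>))) (at (?t \<tau>) within ?t ` {0..})"
    using X[of "?t \<tau>"] t \<tau> by (intro has_vector_derivative_within_subset[OF _ t]) auto
  ultimately have "((X \<circ> ?t) has_vector_derivative
      - ?t \<tau> *\<^sub>R ((1 / (2 * ?t \<tau>)) *\<^sub>R (X (?t \<tau>) - u (?t \<tau>)))) (at \<tau> within {0..})"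
    by (rule vector_diff_chain_within)
  moreover have "- ?t \<tau> * (1 / (2 * ?t \<tau>)) = - 1 / 2"
    using T by simp
  ultimately show ?thesis by (simp only: comp_def scaleR_scaleR)
qed

theorem theorem3p10:
  fixes lam T :: real
    and \<mu>1 \<mu>2 :: "'a::euclidean_space measure"
    and A1 A2 :: "'a set"
    and xT :: 'a
    and X :: "real \<Rightarrow> 'a"
    and \<tau>s :: "nat \<Rightarrow> real"
    and Yj :: "nat \<Rightarrow> real \<Rightarrow> 'a"
  assumes "lam \<ge> 0" and "T > 0"
    and "finite_dirac_mixture \<mu>1" and "finite_dirac_mixture \<mu>2"
    and "A1 = measure_support \<mu>1" and "A2 = measure_support \<mu>2"
    and "generation_solution lam \<mu>1 \<mu>2 T xT X"
    and "\<And>j. \<tau>s j \<ge> 0" and "filterlim \<tau>s at_top sequentially"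
    and "\<And>j. Yj j = shifted_trajectory T X (\<tau>s j)"
  shows "relatively_compact_in C_loc (range Yj)
    \<and> (\<forall>r Z. strict_mono r \<and> limitin C_loc (Yj \<circ> r) Z sequentially \<longrightarrow>
          (lam \<le> 1 \<longrightarrow> caratheodory_solution
             (\<lambda>z. (\<lambda>v. (- 1 / 4) *\<^sub>R v) ` clarke_subdifferential (geometric_potential lam A1 A2) z)
             (Z 0) Z) \<and>
          (lam > 1 \<longrightarrow> caratheodory_solution
             (\<lambda>z. (\<lambda>v. (- 1 / 4) *\<^sub>R v) ` outer_clarke_subdifferential lam A1 A2 z)
             (Z 0) Z))"
proof -
  obtain m1 where A1: "finite A1" "A1 \<noteq> {}" and m1_hull: "\<And>x t. m1 x t \<in> convex hull A1"
    and m1_grad: "\<And>x t. t > 0 \<Longrightarrow> GDERIV (\<lambda>x. ln (heat_flow \<mu>1 x t)) x :> - ((1 / (2 * t)) *\<^sub>R (x - m1 x t))"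
    and m1_near: "\<And>z e. e > 0 \<Longrightarrow> \<exists>r>0. \<forall>y t. dist y z < r \<longrightarrow> 0 < t \<longrightarrow> t < r \<longrightarrow>
       (\<exists>c\<in>convex hull (nearest_points A1 z). norm (m1 y t - c) < e)"
    using finite_dirac_mixture_score[OF assms(3)] unfolding assms(5) by metis
  obtain m2 where A2: "finite A2" "A2 \<noteq> {}" and m2_hull: "\<And>x t. m2 x t \<in> convex hull A2"
    and m2_grad: "\<And>x t. t > 0 \<Longrightarrow> GDERIV (\<lambda>x. ln (heat_flow \<mu>2 x t)) x :> - ((1 / (2 * t)) *\<^sub>R (x - m2 x t))"
    and m2_near: "\<And>z e. e > 0 \<Longrightarrow> \<exists>r>0. \<forall>y t. dist y z < r \<longrightarrow> 0 < t \<longrightarrow> t < r \<longrightarrow>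
       (\<exists>c\<in>convex hull (nearest_points A2 z). norm (m2 y t - c) < e)"
    using finite_dirac_mixture_score[OF assms(4)] unfolding assms(6) by metis
  define P where "P x t = lam *\<^sub>R m1 x t + (1 - lam) *\<^sub>R m2 x t" for x t
  define Y where "Y \<tau> = X (T * exp (- \<tau>))" for \<tau>
  define v where "v \<tau> = (- 1 / 2) *\<^sub>R (Y \<tau> - P (Y \<tau>) (T * exp (- \<tau>)))" for \<tau>

  have grad: "gradient (\<lambda>x. log_potential lam \<mu>1 \<mu>2 x t) x = - ((1 / (2 * t)) *\<^sub>R (x - P x t))"
    if t: "t > 0" for x t
  proof (rule gradient_eqI)
    have "((\<lambda>x. lam * ln (heat_flow \<mu>1 x t) + (1 - lam) * ln (heat_flow \<mu>2 x t)) has_derivative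
        (\<lambda>h. lam * (h \<bullet> - ((1 / (2 * t)) *\<^sub>R (x - m1 x t))) + (1 - lam) * (h \<bullet> - ((1 / (2 * t)) *\<^sub>R (x - m2 x t))))) (at x)"
      using m1_grad[OF t, of x] m2_grad[OF t, of x] unfolding gderiv_def
      by (intro has_derivative_add has_derivative_mult_right)
    also have "(\<lambda>h. lam * (h \<bullet> - ((1 / (2 * t)) *\<^sub>R (x - m1 x t))) + (1 - lam) * (h \<bullet> - ((1 / (2 * t)) *\<^sub>R (x - m2 x t))))
        = (\<lambda>h. h \<bullet> - ((1 / (2 * t)) *\<^sub>R (x - P x t)))"
    proof
      fix h
      define c where "c = 1 / (2 * t)"
      show "lam * (h \<bullet> - ((1 / (2 * t)) *\<^sub>R (x - m1 x t))) + (1 - lam) * (h \<bullet> - ((1 / (2 * t)) *\<^sub>R (x - m2 x t)))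
          = h \<bullet> - ((1 / (2 * t)) *\<^sub>R (x - P x t))"
        unfolding c_def[symmetric] P_def inner_minus_right inner_scaleR_right inner_diff_right inner_add_right
        by (simp add: algebra_simps)
    qed
    finally show "GDERIV (\<lambda>x. log_potential lam \<mu>1 \<mu>2 x t) x :> - ((1 / (2 * t)) *\<^sub>R (x - P x t))"
      by (simp add: gderiv_def log_potential_def)
  qed
  have Xd: "(X has_vector_derivative (1 / (2 * t)) *\<^sub>R (X t - P (X t) t)) (at t within {0<..T})"
    if "t \<in> {0<..T}" for t
  proof -
    have "(X has_vector_derivative - gradient (\<lambda>x. log_potential lam \<mu>1 \<mu>2 x t) (X t)) (at t within {0<..T})"
      using assms(7) that unfolding generation_solution_def by blast
    then show ?thesis using grad[of t "X t"] that by simp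
  qed
  have Yd: "(Y has_vector_derivative v \<tau>) (at \<tau> within {0..})" if "\<tau> \<ge> 0" for \<tau>
    using generation_solution_rescaled[of T X "\<lambda>t. P (X t) t", OF Xd assms(2) that]
    unfolding Y_def v_def .

  obtain R where R: "\<And>x. x \<in> convex hull A1 \<Longrightarrow> norm x \<le> R" "\<And>x. x \<in> convex hull A2 \<Longrightarrow> norm x \<le> R"
  proof -
    have "bounded (convex hull A1 \<union> convex hull A2)"
      using A1 A2 by (intro bounded_Un[THEN iffD2] conjI compact_imp_bounded finite_imp_compact_convex_hull)
    then show ?thesis using that unfolding bounded_iff by blast
  qed
  \<comment> \<open>For \<open>lam > 1\<close> the combination \<open>P\<close> is affine but not
    convex, hence the absolute values.\<close>
  define B where "B = \<bar>lam\<bar> * R + \<bar>1 - lam\<bar> * R"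
  have PB: "norm (P x t) \<le> B" for x t
  proof -
    have "norm (P x t) \<le> \<bar>lam\<bar> * norm (m1 x t) + \<bar>1 - lam\<bar> * norm (m2 x t)"
      unfolding P_def by (rule norm_triangle_le) simp
    also have "\<dots> \<le> B"
      unfolding B_def by (intro add_mono mult_left_mono R m1_hull m2_hull) auto
    finally show ?thesis .
  qed
  have B0: "B \<ge> 0" using PB norm_ge_zero by (rule order_trans[rotated])
  define M where "M = norm (Y 0) + B"
  have YM: "norm (Y \<tau>) \<le> M" if "\<tau> \<ge> 0" for \<tau>
    unfolding M_def
    using Yd[unfolded v_def] PB that by (rule relaxation_bounded)
  define L where "L = (M + B) / 2"
  have L0: "L \<ge> 0" using B0 by (simp add: L_def M_def)
  have Ylip: "L-lipschitz_on {0..} Y"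
  proof (rule vector_derivative_bounded_imp_lipschitz[OF Yd])
    fix \<tau> :: real assume "\<tau> \<in> {0..}"
    then have "norm (Y \<tau> - P (Y \<tau>) (T * exp (- \<tau>))) \<le> M + B"
      using YM[of \<tau>] PB by (intro norm_triangle_le_diff add_mono) auto
    then show "norm (v \<tau>) \<le> L" by (simp add: v_def L_def)
  qed (use L0 in auto)
  have Yj: "Yj j \<tau> = Y (\<tau> + \<tau>s j)" if "\<tau> \<ge> 0" for j \<tau>
    using that by (simp add: assms(10) shifted_trajectory_def Y_def)
  have Yjlip: "L-lipschitz_on {0..} (Yj j)" for j
  proof (rule lipschitz_onI[OF _ L0])
    fix s t :: real assume "s \<in> {0..}" "t \<in> {0..}"
    then show "dist (Yj j s) (Yj j t) \<le> L * dist s t"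
      using lipschitz_onD[OF Ylip, of "s + \<tau>s j" "t + \<tau>s j"] assms(8)[of j] by (simp add: Yj)
  qed
  have Yjext: "Yj j \<in> extensional {0..}" for j
    unfolding assms(10) shifted_trajectory_def by (rule restrict_extensional)
  have "relatively_compact_in C_loc (range Yj)"
  proof (rule relatively_compact_in_C_loc_lipschitz)
    show "norm (f t) \<le> M" if "f \<in> range Yj" "t \<ge> 0" for f t
      using that assms(8) by (auto simp: Yj intro!: YM)
  qed (use Yjext Yjlip in auto)
  moreover have sol: "caratheodory_solution (nearest_hull_field lam A1 A2) (Z 0) Z"
    if r: "strict_mono r" and lim: "limitin C_loc (Yj \<circ> r) Z sequentially" for r Z
  proof (rule caratheodory_solution_limit)
    have "(Yj \<circ> r) j \<in> C_space" for j
      using Yjext lipschitz_on_continuous_on[OF Yjlip] by (simp add: C_space_def)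
    with lim have unif: "uniform_limit K (Yj \<circ> r) Z sequentially" if "compact K" "K \<subseteq> {0..}" for K
      using that by (simp add: limitin_C_loc_iff)
    \<comment> \<open>The approximating curves are shifts of the unrestricted \<open>Y\<close>,
      which agree with \<open>Yj (r j)\<close> at nonnegative times.\<close>
    show limY: "(\<lambda>j. Y (\<tau> + \<tau>s (r j))) \<longlonglongrightarrow> Z \<tau>" if "\<tau> \<ge> 0" for \<tau>
      using tendsto_uniform_limitI[OF unif[of "{\<tau>}"], of \<tau>] that by (simp add: Yj)
    show "L-lipschitz_on {0..} Z"
    proof (rule lipschitz_onI[OF _ L0])
      fix s t :: real assume st: "s \<in> {0..}" "t \<in> {0..}"
      have "(\<lambda>j. dist (Y (s + \<tau>s (r j))) (Y (t + \<tau>s (r j)))) \<longlonglongrightarrow> dist (Z s) (Z t)"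
        using st by (intro tendsto_dist limY) auto
      moreover have "dist (Y (s + \<tau>s (r j))) (Y (t + \<tau>s (r j))) \<le> L * dist s t" for j
        using lipschitz_onD[OF Yjlip st, of "r j"] st by (simp add: Yj)
      ultimately show "dist (Z s) (Z t) \<le> L * dist s t" by (intro LIMSEQ_le_const2) auto
    qed
    show "((\<lambda>\<tau>. Y (\<tau> + \<tau>s (r j))) has_vector_derivative v (\<tau> + \<tau>s (r j))) (at \<tau> within {0..})"
      if "\<tau> \<ge> 0" for j \<tau>
    proof -
      have "((\<lambda>\<tau>. \<tau> + \<tau>s (r j)) has_vector_derivative 1) (at \<tau> within {0..})"
        by (auto intro!: derivative_eq_intros)
      moreover have "(Y has_vector_derivative v (\<tau> + \<tau>s (r j))) (at (\<tau> + \<tau>s (r j)) within (\<lambda>\<tau>. \<tau> + \<tau>s (r j)) ` {0..})"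
        using that assms(8)[of "r j"] by (intro has_vector_derivative_within_subset[OF Yd]) auto
      ultimately show ?thesis
        using vector_diff_chain_within by (fastforce simp: comp_def)
    qed
    show "\<exists>d>0. \<exists>J. \<forall>j\<ge>J. \<forall>s. t \<le> s \<and> s < t + d \<longrightarrow>
        (\<exists>c\<in>nearest_hull_field lam A1 A2 (Z t). norm (v (s + \<tau>s (r j)) - c) < e)"
      if t: "t \<ge> 0" and e: "e > 0" for t e
    proof -
      \<comment> \<open>The velocity error has three sources, the position and the two means, with
        coefficients 1, \<open>\<bar>lam\<bar>\<close> and
        \<open>\<bar>1 - lam\<bar>\<close>.\<close>
      define e' where "e' = e / (1 + \<bar>lam\<bar> + \<bar>1 - lam\<bar>)"
      have e': "e' > 0" using e by (simp add: e'_def add_pos_nonneg)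
      obtain r1 where r1: "r1 > 0" "\<And>y t'. dist y (Z t) < r1 \<Longrightarrow> 0 < t' \<Longrightarrow> t' < r1 \<Longrightarrow>
          \<exists>c\<in>convex hull (nearest_points A1 (Z t)). norm (m1 y t' - c) < e'"
        using m1_near[OF e'] by blast
      obtain r2 where r2: "r2 > 0" "\<And>y t'. dist y (Z t) < r2 \<Longrightarrow> 0 < t' \<Longrightarrow> t' < r2 \<Longrightarrow>
          \<exists>c\<in>convex hull (nearest_points A2 (Z t)). norm (m2 y t' - c) < e'"
        using m2_near[OF e'] by blast
      define \<rho> where "\<rho> = min e' (min r1 r2)"
      have \<rho>: "\<rho> > 0" "\<rho> \<le> e'" "\<rho> \<le> r1" "\<rho> \<le> r2" using e' r1 r2 by (auto simp: \<rho>_def)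
      \<comment> \<open>Half of \<open>\<rho>\<close> covers the Lipschitz drift over a time less
        than \<open>d\<close>, the other half the convergence at the single time
        \<open>t\<close>.\<close>
      define d where "d = \<rho> / (2 * (L + 1))"
      have d: "d > 0" using \<rho> L0 by (simp add: d_def)
      have Ld: "L * d \<le> \<rho> / 2"
      proof -
        have "L * d \<le> (L + 1) * d" using d by simp
        also have "\<dots> = \<rho> / 2" using L0 by (simp add: d_def field_simps)
        finally show ?thesis .
      qed
      have "\<forall>\<^sub>F j in sequentially. dist (Y (t + \<tau>s (r j))) (Z t) < \<rho> / 2"
        using limY[OF t] \<rho> by (intro tendstoD) auto
      moreover have "\<forall>\<^sub>F j in sequentially. T * exp (- \<tau>s (r j)) < \<rho>"
      proof -
        have "filterlim (\<lambda>j. \<tau>s (r j)) at_top sequentially"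
          using assms(9) filterlim_subseq[OF r] by (rule filterlim_compose)
        then have "filterlim (\<lambda>j. - \<tau>s (r j)) at_bot sequentially"
          by (simp add: filterlim_uminus_at_bot)
        then have "(\<lambda>j. exp (- \<tau>s (r j))) \<longlonglongrightarrow> 0"
          by (rule filterlim_compose[OF exp_at_bot])
        then have "(\<lambda>j. T * exp (- \<tau>s (r j))) \<longlonglongrightarrow> 0"
          by (rule tendsto_mult_right_zero)
        then show ?thesis using \<rho>(1) by (rule order_tendstoD)
      qed
      ultimately have "\<forall>\<^sub>F j in sequentially. dist (Y (t + \<tau>s (r j))) (Z t) < \<rho> / 2 \<and> T * exp (- \<tau>s (r j)) < \<rho>"
        by (rule eventually_conj)
      then obtain J where J: "\<And>j. j \<ge> J \<Longrightarrow> dist (Y (t + \<tau>s (r j))) (Z t) < \<rho> / 2"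
          "\<And>j. j \<ge> J \<Longrightarrow> T * exp (- \<tau>s (r j)) < \<rho>"
        unfolding eventually_sequentially by blast
      have "\<exists>c\<in>nearest_hull_field lam A1 A2 (Z t). norm (v (s + \<tau>s (r j)) - c) < e"
        if j: "j \<ge> J" and s: "t \<le> s" "s < t + d" for j s
      proof -
        let ?y = "Y (s + \<tau>s (r j))" and ?t = "T * exp (- (s + \<tau>s (r j)))"
        have "dist ?y (Y (t + \<tau>s (r j))) \<le> L * dist s t"
          using lipschitz_onD[OF Ylip, of "s + \<tau>s (r j)" "t + \<tau>s (r j)"] s t assms(8)[of "r j"] by simp
        also have "\<dots> \<le> L * d" using s L0 by (intro mult_left_mono) (auto simp: dist_real_def)
        finally have y: "dist ?y (Z t) < \<rho>"
          using J(1)[OF j] Ld dist_triangle[of ?y "Z t" "Y (t + \<tau>s (r j))"] by simp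
        \<comment> \<open>Original time decreases in \<open>s\<close>, so the smallness at
          \<open>s = 0\<close> covers the whole interval.\<close>
        have "?t \<le> T * exp (- \<tau>s (r j))" using s t assms(2) by simp
        then have t': "0 < ?t" "?t < \<rho>" using J(2)[OF j] assms(2) by (simp, linarith)
        obtain c1 where c1: "c1 \<in> convex hull (nearest_points A1 (Z t))" "norm (m1 ?y ?t - c1) < e'"
          using r1(2)[of ?y ?t] y t' \<rho> by auto
        obtain c2 where c2: "c2 \<in> convex hull (nearest_points A2 (Z t))" "norm (m2 ?y ?t - c2) < e'"
          using r2(2)[of ?y ?t] y t' \<rho> by auto
        let ?c = "(- 1 / 2) *\<^sub>R (Z t - lam *\<^sub>R c1 - (1 - lam) *\<^sub>R c2)"
        have "v (s + \<tau>s (r j)) - ?c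
            = (- 1 / 2) *\<^sub>R ((?y - Z t) - (lam *\<^sub>R (m1 ?y ?t - c1) + (1 - lam) *\<^sub>R (m2 ?y ?t - c2)))"
          unfolding v_def P_def scaleR_diff_right[symmetric]
          by (rule arg_cong[where f = "\<lambda>x. (- 1 / 2) *\<^sub>R x"]) (simp add: scaleR_diff_right)
        also have "norm \<dots> = norm ((?y - Z t) - (lam *\<^sub>R (m1 ?y ?t - c1) + (1 - lam) *\<^sub>R (m2 ?y ?t - c2))) / 2"
          by simp
        also have "\<dots> \<le> (e' + (\<bar>lam\<bar> * e' + \<bar>1 - lam\<bar> * e')) / 2"
        proof (rule divide_right_mono)
          let ?b = "lam *\<^sub>R (m1 ?y ?t - c1)" and ?c = "(1 - lam) *\<^sub>R (m2 ?y ?t - c2)"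
          have "norm ((?y - Z t) - (?b + ?c)) \<le> norm (?y - Z t) + norm (?b + ?c)"
            by (rule norm_triangle_ineq4)
          moreover have "norm (?b + ?c) \<le> norm ?b + norm ?c" by (rule norm_triangle_ineq)
          moreover have "norm (?y - Z t) \<le> e'" using y \<rho> by (simp add: dist_norm)
          moreover have "norm ?b \<le> \<bar>lam\<bar> * e'" using c1 by (simp add: mult_left_mono)
          moreover have "norm ?c \<le> \<bar>1 - lam\<bar> * e'" using c2 by (simp add: mult_left_mono)
          ultimately show "norm ((?y - Z t) - (?b + ?c)) \<le> e' + (\<bar>lam\<bar> * e' + \<bar>1 - lam\<bar> * e')"
            by linarith
        qed simp
        also have "\<dots> = e' * (1 + \<bar>lam\<bar> + \<bar>1 - lam\<bar>) / 2" by (simp add: algebra_simps)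
        also have "\<dots> = e / 2"
        proof -
          have "1 + \<bar>lam\<bar> + \<bar>1 - lam\<bar> > 0" by linarith
          then show ?thesis by (simp add: e'_def)
        qed
        also have "\<dots> < e" using e by simp
        finally have "norm (v (s + \<tau>s (r j)) - ?c) < e" .
        then show ?thesis using c1(1) c2(1) unfolding nearest_hull_field_def by blast
      qed
      then show ?thesis using d by blast
    qed
  qed (rule nearest_hull_field_convex_closed[OF A1(1) A2(1)])+
  ultimately show ?thesis
    using caratheodory_solution_mono[OF sol nearest_hull_field_subset_clarke[OF A1 A2 assms(1)]]
      caratheodory_solution_mono[OF sol nearest_hull_field_subset_outer_clarke[OF A1 A2]]
    by blast
qed

end
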